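(* Let $\{(X^k,Y^k,S^k)\}$ be the sequence generated by the JA-PG algorithm for problem (GF). Then any accumulation point $(X^*,Y^*,S^* )$ of $\{(X^k,Y^k,S^k)\}$ is a limiting-critical point of problem (GF), that is, $\bm 0\in\partial G(X^*,Y^*,S^* )$.
   Context: Problem (GF): minimize $G(X,Y,S):=f(XY^{\mathbb{T}},S)+\lambda(u(X)+v(Y))+\beta w(S)$ over $(X,Y,S)\in\mathbb{R}^{m\times d}\times\mathbb{R}^{n\times d}\times\mathbb{R}^{m\times n}$, where $f:\mathbb{R}^{m\times n}\times\mathbb{R}^{m\times n}\to\mathbb{R}$, $(Z,S)\mapsto f(Z,S)$, is differentiable with locally Lipschitz continuous gradient, $\lambda,\beta\ge0$, and $u:\mathbb{R}^{m\times d}\to(-\infty,+\infty]$, $v:\mathbb{R}^{n\times d}\to(-\infty,+\infty]$, $w:\mathbb{R}^{m\times n}\to(-\infty,+\infty]$ are proper, lower semicontinuous and bounded from below by affine functions. It is assumed that $\inf G>-\infty$. $\partial$ is the limiting (Mordukhovich) subdifferential; norms are Frobenius norms. Notation: $f_J(X,Y;\bar S):=f(XY^{\mathbb{T}},\bar S)+\lambda(u(X)+v(Y))$; $f_A(S;\bar X,\bar Y):=f(\bar X\bar Y^{\mathbb{T}},S)+\beta w(S)$; $\omega_J(X,Y;\bar X,\bar Y,\bar S,\iota_1,\iota_2):=\lambda(u(X)+v(Y))+\langle\nabla_Zf(\bar X\bar Y^{\mathbb{T}},\bar S)\bar Y,X-\bar X\rangle+\langle\nabla_Zf(\bar X\bar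 Y^{\mathbb{T}},\bar S)^{\mathbb{T}}\bar X,Y-\bar Y\rangle+\frac{\iota_1}{2}\|X-\bar X\|_F^2+\frac{\iota_2}{2}\|Y-\bar Y\|_F^2$; $\omega_A(S;\bar X,\bar Y,\bar S,\iota):=\beta w(S)+\langle\nabla_Sf(\bar X\bar Y^{\mathbb{T}},\bar S),S-\bar S\rangle+\frac{\iota}{2}\|S-\bar S\|_F^2$. JA-PG algorithm. Choose $(X^0,Y^0,S^0)\in\mathrm{dom}(G)$, $0<\underline\iota\le\overline\iota$, $0<c_{\min}\le c_{\max}$, $\varrho>1$, sequences $\{\iota^B_{1,k}\},\{\iota^B_{2,k}\},\{\iota^B_k\}\subseteq[\underline\iota,\overline\iota]$ and $\{c_{1,k}\},\{c_{2,k}\}\subseteq[c_{\min},c_{\max}]$. For $k=0,1,2,\dots$: Step 1: for $l=1,2,\dots$ set $\iota_{1,k}=\iota^B_{1,k}\varrho^{l-1}$, $\iota_{2,k}=\iota^B_{2,k}\varrho^{l-1}$, compute some $(X^+,Y^+)\in\mathrm{argmin}_{(X,Y)}\,\omega_J(X,Y;X^k,Y^k,S^k,\iota_{1,k},\iota_{2,k})$; as soon as $f_J(X^+,Y^+;S^k)\le f_J(X^k,Y^k;S^k)-\frac{c_{1,k}}{2}\|(X^+,Y^+)-(X^k,Y^k)\|_F^2$, stop the inner loop and set $(X^{k+1},Y^{k+1})=(X^+,Y^+)$. Step 2: for $l=1,2,\dots$ set $\iota_k=\iota^B_k\varrho^{l-1}$, compute some $S^+\in\mathrm{argmin}_S\,\omega_A(S;X^{k+1},Y^{k+1},S^k,\iota_k)$;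 as soon as $f_A(S^+;X^{k+1},Y^{k+1})\le f_A(S^k;X^{k+1},Y^{k+1})-\frac{c_{2,k}}{2}\|S^+-S^k\|_F^2$, stop the inner loop and set $S^{k+1}=S^+$. *)

theory Defs
  imports "HOL-Analysis.Analysis"
begin

section \<open>Extended-real-valued functions and limiting subdifferentials\<close>

definition proper_fun :: "('a \<Rightarrow> ereal) \<Rightarrow> bool" where
  "proper_fun h \<longleftrightarrow> (\<forall>x. h x \<noteq> -\<infinity>) \<and> (\<exists>x. h x \<noteq> \<infinity>)"

definition lsc_fun :: "('a::topological_space \<Rightarrow> ereal) \<Rightarrow> bool" where
  "lsc_fun h \<longleftrightarrow> (\<forall>x. h x \<le> Liminf (at x) h)"

definition affinely_minorized :: "('a::real_inner \<Rightarrow> ereal) \<Rightarrow> bool" where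
  "affinely_minorized h \<longleftrightarrow> (\<exists>a b. \<forall>x. ereal (a \<bullet> x + b) \<le> h x)"

definition effective_domain :: "('a \<Rightarrow> ereal) \<Rightarrow> 'a set" where
  "effective_domain h = {x. h x < \<infinity>}"

definition regular_subdifferential :: "('a::real_inner \<Rightarrow> ereal) \<Rightarrow> 'a \<Rightarrow> 'a set" where
  "regular_subdifferential h x =
     {v. \<bar>h x\<bar> \<noteq> \<infinity> \<and>
         0 \<le> Liminf (at x) (\<lambda>y. (h y - h x - ereal (v \<bullet> (y - x))) / ereal (norm (y - x)))}"

definition limiting_subdifferential :: "('a::real_inner \<Rightarrow> ereal) \<Rightarrow> 'a \<Rightarrow> 'a set" where
  "limiting_subdifferential h x =
     {v. \<bar>h x\<bar> \<noteq> \<infinity> \<and>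
         (\<exists>xs vs. xs \<longlonglongrightarrow> x \<and> (\<lambda>k. h (xs k)) \<longlonglongrightarrow> h x \<and> vs \<longlonglongrightarrow> v \<and>
            (\<forall>k::nat. vs k \<in> regular_subdifferential h (xs k)))}"


section \<open>Gradients\<close>

definition gradient :: "('a::real_inner \<Rightarrow> real) \<Rightarrow> 'a \<Rightarrow> 'a" where
  "gradient h x = (THE D. GDERIV h x :> D)"

lemma gradient_eqI: "GDERIV h x :> D \<Longrightarrow> gradient h x = D"
  unfolding gradient_def
proof (rule the_equality)
  fix D' assume "GDERIV h x :> D" "GDERIV h x :> D'"
  then have "(\<lambda>y. y \<bullet> D') = (\<lambda>y. y \<bullet> D)"
    unfolding gderiv_def by (metis has_derivative_unique)
  then show "D' = D"
    by (metis vector_eq_ldot)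
qed

abbreviation gradient_Z :: "('a::real_inner \<times> 'b::real_inner \<Rightarrow> real) \<Rightarrow> 'a \<Rightarrow> 'b \<Rightarrow> 'a" where
  "gradient_Z f Z S \<equiv> gradient (\<lambda>Z'. f (Z', S)) Z"

abbreviation gradient_S :: "('a::real_inner \<times> 'b::real_inner \<Rightarrow> real) \<Rightarrow> 'a \<Rightarrow> 'b \<Rightarrow> 'b" where
  "gradient_S f Z S \<equiv> gradient (\<lambda>S'. f (Z, S')) S"

definition locally_lipschitz :: "('a::metric_space \<Rightarrow> 'b::metric_space) \<Rightarrow> bool" where
  "locally_lipschitz g \<longleftrightarrow> (\<forall>x. \<exists>r>0. \<exists>L. L-lipschitz_on (ball x r) g)"


section \<open>The factorized problem\<close>

text \<open>
  An m by d real matrix has type \<^typ>\<open>real ^ 'd ^ 'm\<close>; the library's norm and inner product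
  on this type are the Frobenius ones, and the norm of a pair is the square root of the sum of
  the squared norms. In \<^typ>\<open>ereal\<close> we have \<open>0 * \<infinity> = 0\<close>, so a term with zero weight is absent
  from the objective.
\<close>

definition GF_objective ::
  "((real^'n^'m) \<times> (real^'n^'m) \<Rightarrow> real) \<Rightarrow> (real^'d^'m \<Rightarrow> ereal) \<Rightarrow> (real^'d^'n \<Rightarrow> ereal) \<Rightarrow>
   (real^'n^'m \<Rightarrow> ereal) \<Rightarrow> real \<Rightarrow> real \<Rightarrow>
   (real^'d^'m) \<times> (real^'d^'n) \<times> (real^'n^'m) \<Rightarrow> ereal" where
  "GF_objective f u v w lam \<beta> = (\<lambda>(X, Y, S).
     ereal (f (X ** transpose Y, S)) + ereal lam * (u X + v Y) + ereal \<beta> * w S)"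

definition f_J ::
  "((real^'n^'m) \<times> (real^'n^'m) \<Rightarrow> real) \<Rightarrow> (real^'d^'m \<Rightarrow> ereal) \<Rightarrow> (real^'d^'n \<Rightarrow> ereal) \<Rightarrow>
   real \<Rightarrow> real^'n^'m \<Rightarrow> (real^'d^'m) \<times> (real^'d^'n) \<Rightarrow> ereal" where
  "f_J f u v lam Sb = (\<lambda>(X, Y). ereal (f (X ** transpose Y, Sb)) + ereal lam * (u X + v Y))"

definition f_A ::
  "((real^'n^'m) \<times> (real^'n^'m) \<Rightarrow> real) \<Rightarrow> (real^'n^'m \<Rightarrow> ereal) \<Rightarrow> real \<Rightarrow>
   real^'d^'m \<Rightarrow> real^'d^'n \<Rightarrow> real^'n^'m \<Rightarrow> ereal" where
  "f_A f w \<beta> Xb Yb = (\<lambda>S. ereal (f (Xb ** transpose Yb, S)) + ereal \<beta> * w S)"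

definition \<omega>_J ::
  "((real^'n^'m) \<times> (real^'n^'m) \<Rightarrow> real) \<Rightarrow> (real^'d^'m \<Rightarrow> ereal) \<Rightarrow> (real^'d^'n \<Rightarrow> ereal) \<Rightarrow>
   real \<Rightarrow> real^'d^'m \<Rightarrow> real^'d^'n \<Rightarrow> real^'n^'m \<Rightarrow> real \<Rightarrow> real \<Rightarrow>
   (real^'d^'m) \<times> (real^'d^'n) \<Rightarrow> ereal" where
  "\<omega>_J f u v lam Xb Yb Sb \<iota>1 \<iota>2 = (\<lambda>(X, Y).
     ereal lam * (u X + v Y)
     + ereal ((gradient_Z f (Xb ** transpose Yb) Sb ** Yb) \<bullet> (X - Xb)
            + (transpose (gradient_Z f (Xb ** transpose Yb) Sb) ** Xb) \<bullet> (Y - Yb)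
            + \<iota>1 / 2 * (norm (X - Xb))\<^sup>2 + \<iota>2 / 2 * (norm (Y - Yb))\<^sup>2))"

definition \<omega>_A ::
  "((real^'n^'m) \<times> (real^'n^'m) \<Rightarrow> real) \<Rightarrow> (real^'n^'m \<Rightarrow> ereal) \<Rightarrow> real \<Rightarrow>
   real^'d^'m \<Rightarrow> real^'d^'n \<Rightarrow> real^'n^'m \<Rightarrow> real \<Rightarrow> real^'n^'m \<Rightarrow> ereal" where
  "\<omega>_A f w \<beta> Xb Yb Sb \<iota> = (\<lambda>S.
     ereal \<beta> * w S
     + ereal (gradient_S f (Xb ** transpose Yb) Sb \<bullet> (S - Sb) + \<iota> / 2 * (norm (S - Sb))\<^sup>2))"


section \<open>The JA-PG algorithm\<close>

text \<open>
  \<open>backtracking trial accept z\<close> says that \<open>z\<close> is the result of an inner loop: for \<open>l = 1, 2, \<dots>\<close>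
  some candidate satisfying \<open>trial l\<close> is computed, and the first one that satisfies \<open>accept\<close> is
  returned. The candidates are existentially quantified because the subproblems may have several
  minimizers.
\<close>

definition backtracking :: "(nat \<Rightarrow> 'a \<Rightarrow> bool) \<Rightarrow> ('a \<Rightarrow> bool) \<Rightarrow> 'a \<Rightarrow> bool" where
  "backtracking trial accept z \<longleftrightarrow>
     (\<exists>N\<ge>1. \<exists>t. (\<forall>l\<in>{1..N}. trial l (t l)) \<and> (\<forall>l\<in>{1..<N}. \<not> accept (t l)) \<and>
               accept (t N) \<and> z = t N)"

definition JA_PG_step1 ::
  "((real^'n^'m) \<times> (real^'n^'m) \<Rightarrow> real) \<Rightarrow> (real^'d^'m \<Rightarrow> ereal) \<Rightarrow> (real^'d^'n \<Rightarrow> ereal) \<Rightarrow>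
   real \<Rightarrow> real \<Rightarrow> real \<Rightarrow> real \<Rightarrow> real \<Rightarrow>
   real^'d^'m \<Rightarrow> real^'d^'n \<Rightarrow> real^'n^'m \<Rightarrow> real^'d^'m \<Rightarrow> real^'d^'n \<Rightarrow> bool" where
  "JA_PG_step1 f u v lam \<rho> \<iota>B1 \<iota>B2 c X Y S X' Y' \<longleftrightarrow>
     backtracking
       (\<lambda>l. is_arg_min (\<omega>_J f u v lam X Y S (\<iota>B1 * \<rho> ^ (l - 1)) (\<iota>B2 * \<rho> ^ (l - 1))) (\<lambda>_. True))
       (\<lambda>P. f_J f u v lam S P \<le> f_J f u v lam S (X, Y) - ereal (c / 2 * (norm (P - (X, Y)))\<^sup>2))
       (X', Y')"

definition JA_PG_step2 ::
  "((real^'n^'m) \<times> (real^'n^'m) \<Rightarrow> real) \<Rightarrow> (real^'n^'m \<Rightarrow> ereal) \<Rightarrow>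
   real \<Rightarrow> real \<Rightarrow> real \<Rightarrow> real \<Rightarrow>
   real^'d^'m \<Rightarrow> real^'d^'n \<Rightarrow> real^'n^'m \<Rightarrow> real^'n^'m \<Rightarrow> bool" where
  "JA_PG_step2 f w \<beta> \<rho> \<iota>B c X' Y' S S' \<longleftrightarrow>
     backtracking
       (\<lambda>l. is_arg_min (\<omega>_A f w \<beta> X' Y' S (\<iota>B * \<rho> ^ (l - 1))) (\<lambda>_. True))
       (\<lambda>T. f_A f w \<beta> X' Y' T \<le> f_A f w \<beta> X' Y' S - ereal (c / 2 * (norm (T - S))\<^sup>2))
       S'"

definition JA_PG_sequence ::
  "((real^'n^'m) \<times> (real^'n^'m) \<Rightarrow> real) \<Rightarrow> (real^'d^'m \<Rightarrow> ereal) \<Rightarrow> (real^'d^'n \<Rightarrow> ereal) \<Rightarrow>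
   (real^'n^'m \<Rightarrow> ereal) \<Rightarrow> real \<Rightarrow> real \<Rightarrow> real \<Rightarrow>
   (nat \<Rightarrow> real) \<Rightarrow> (nat \<Rightarrow> real) \<Rightarrow> (nat \<Rightarrow> real) \<Rightarrow> (nat \<Rightarrow> real) \<Rightarrow> (nat \<Rightarrow> real) \<Rightarrow>
   (nat \<Rightarrow> real^'d^'m) \<Rightarrow> (nat \<Rightarrow> real^'d^'n) \<Rightarrow> (nat \<Rightarrow> real^'n^'m) \<Rightarrow> bool" where
  "JA_PG_sequence f u v w lam \<beta> \<rho> \<iota>B1 \<iota>B2 \<iota>B c1 c2 X Y S \<longleftrightarrow>
     (X 0, Y 0, S 0) \<in> effective_domain (GF_objective f u v w lam \<beta>) \<and>
     (\<forall>k. JA_PG_step1 f u v lam \<rho> (\<iota>B1 k) (\<iota>B2 k) (c1 k)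
            (X k) (Y k) (S k) (X (Suc k)) (Y (Suc k)) \<and>
          JA_PG_step2 f w \<beta> \<rho> (\<iota>B k) (c2 k) (X (Suc k)) (Y (Suc k)) (S k) (S (Suc k)))"

definition accumulation_point :: "(nat \<Rightarrow> 'a::topological_space) \<Rightarrow> 'a \<Rightarrow> bool" where
  "accumulation_point z z' \<longleftrightarrow> (\<exists>r. strict_mono (r :: nat \<Rightarrow> nat) \<and> (z \<circ> r) \<longlonglongrightarrow> z')"

end

theory Submission
  imports Defs
begin

text \<open>
  Sufficient decrease and \<open>inf G > -\<infinity>\<close> make the steps tend to zero, so along a subsequence
  converging to the accumulation point all neighbouring iterates have the same limit. No global
  Lipschitz constant is available. Near the limit, however, the affine minorants keep the trial points
  of a model with a large quadratic term close to the current iterate, where the local Lipschitz bound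
  makes the descent test succeed; hence the accepted step sizes stay bounded along the subsequence.
  Boundedness gives two things: comparing the model at the new iterate with its value at the limit
  point yields convergence of the nonsmooth values, and the residuals in the optimality conditions of
  the subproblems tend to zero.
\<close>

text \<open>The product X Y^T makes the gradient of the smooth part a product of unbounded factors,
  so it is in general only locally Lipschitz even for very regular \<open>f\<close>; this is why no
  step size bound holds along the whole sequence. The bound near the limit must be uniform in the
  iterates. Its threshold depends on a bound for the nonsmooth value at the current iterate, and
  that bound comes from the decrease of G together with the affine minorant of the other block. The
  argument runs for two abstract blocks, p = (X, Y) and S, with the matrix product hidden in the
  smooth function. Optimality of a subproblem is expressed by a global quadratic minorant of the
  nonsmooth term instead of a subdifferential inclusion: minorants of the two blocks simply add, and
  a differentiable function can then be added by hand, so regular subgradients of G arise at the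
  iterates without any sum rule. Convergence of the nonsmooth values is indispensable because the
  limiting subdifferential only admits sequences along which the function values converge.\<close>

section \<open>One proximal gradient step\<close>

text \<open>
  The quadratic term of a model is \<open>D d \<bullet> d / 2\<close> with a self-adjoint operator \<open>D\<close>, so that the joint
  step in \<open>(X, Y)\<close>, which weights its two components differently, is a single proximal step.
\<close>
definition prox_operator :: "real \<Rightarrow> real \<Rightarrow> ('a::real_inner \<Rightarrow> 'a) \<Rightarrow> bool" where
  "prox_operator m M D \<longleftrightarrow> linear D \<and> (\<forall>x y. D x \<bullet> y = x \<bullet> D y) \<and>
     (\<forall>x. m * (norm x)\<^sup>2 \<le> D x \<bullet> x) \<and> (\<forall>x. norm (D x) \<le> M * norm x)"

definition prox_model :: "('a::real_inner \<Rightarrow> ereal) \<Rightarrow> ('a \<Rightarrow> 'a) \<Rightarrow> 'a \<Rightarrow> 'a \<Rightarrow> 'a \<Rightarrow> ereal" where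
  "prox_model \<phi> D g x = (\<lambda>p. \<phi> p + ereal (g \<bullet> (p - x) + D (p - x) \<bullet> (p - x) / 2))"

definition prox_step ::
  "('a::real_inner \<Rightarrow> ereal) \<Rightarrow> ('a \<Rightarrow> real) \<Rightarrow> real \<Rightarrow> ('a \<Rightarrow> 'a) \<Rightarrow> 'a \<Rightarrow> real \<Rightarrow> 'a \<Rightarrow> 'a \<Rightarrow> bool" where
  "prox_step \<phi> H \<rho> D g c x x' \<longleftrightarrow>
     backtracking
       (\<lambda>l. is_arg_min (prox_model \<phi> (\<lambda>d. \<rho> ^ (l - 1) *\<^sub>R D d) g x) (\<lambda>_. True))
       (\<lambda>p. ereal (H p) + \<phi> p \<le> ereal (H x) + \<phi> x - ereal (c / 2 * (norm (p - x))\<^sup>2))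
       x'"

lemma prox_operator_scaleR:
  assumes "prox_operator m M D" "0 \<le> r"
  shows "prox_operator (r * m) (r * M) (\<lambda>d. r *\<^sub>R D d)"
  using assms unfolding prox_operator_def
  by (auto simp: linear_compose_scale_right mult.assoc intro!: mult_left_mono)

lemma prox_model_argmin_le:
  assumes "is_arg_min (prox_model \<phi> D g x) (\<lambda>_. True) x'"
  shows "\<phi> x' + ereal (g \<bullet> (x' - x) + D (x' - x) \<bullet> (x' - x) / 2)
       \<le> \<phi> y + ereal (g \<bullet> (y - x) + D (y - x) \<bullet> (y - x) / 2)"
  using assms unfolding is_arg_min_def prox_model_def by (auto simp: not_less)

text \<open>Expanding the quadratic term around \<open>x'\<close> by self-adjointness turns
  minimality into this bound. The vector \<open>g + D (x' - x)\<close> is the gradient at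
  \<open>x'\<close> of the smooth part of the model, so its negative is a proximal subgradient of
  \<open>\<phi>\<close>; the inequality plays the role of Fermat's rule.\<close>

lemma prox_model_argmin_minorant:
  assumes D: "prox_operator m M D"
    and min: "is_arg_min (prox_model \<phi> D g x) (\<lambda>_. True) x'"
    and fin: "\<phi> x' = ereal p"
  shows "ereal (p - (g + D (x' - x)) \<bullet> (y - x') - M / 2 * (norm (y - x'))\<^sup>2) \<le> \<phi> y"
proof -
  define d e where "d = x' - x" and "e = y - x'"
  have split: "y - x = d + e" by (simp add: d_def e_def)
  have lin: "linear D" and sa: "D a \<bullet> b = a \<bullet> D b" and bd: "norm (D a) \<le> M * norm a" for a b
    using D by (auto simp: prox_operator_def)
  have "D d \<bullet> e = D e \<bullet> d" using sa by (metis inner_commute)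
  then have sq: "D (d + e) \<bullet> (d + e) = D d \<bullet> d + 2 * (D d \<bullet> e) + D e \<bullet> e"
    by (simp add: linear_add[OF lin] inner_add_left inner_add_right)
  have "D e \<bullet> e \<le> norm (D e) * norm e" by (rule norm_cauchy_schwarz)
  also have "\<dots> \<le> M * norm e * norm e" by (intro mult_right_mono bd) auto
  finally have De: "D e \<bullet> e \<le> M * (norm e)\<^sup>2" by (simp add: power2_eq_square mult.assoc)
  have "ereal p + ereal (g \<bullet> d + D d \<bullet> d / 2)
      \<le> \<phi> y + ereal (g \<bullet> (d + e) + (D d \<bullet> d + 2 * (D d \<bullet> e) + D e \<bullet> e) / 2)"
    using prox_model_argmin_le[OF min, of y] unfolding split sq fin d_def[symmetric] .
  with De show ?thesis unfolding e_def[symmetric] d_def[symmetric]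
    by (cases "\<phi> y") (auto simp: inner_add_left inner_add_right field_simps)
qed

text \<open>
  Backtracking accepts as soon as the quadratic term is large enough: the affine minorant of
  \<open>\<phi>\<close> then forces the trial point into the ball where the gradient is Lipschitz.
\<close>
lemma large_quadratic_term_accepted:
  fixes \<phi> :: "'a::real_inner \<Rightarrow> ereal"
  assumes minor: "\<And>x. ereal (a \<bullet> x + b) \<le> \<phi> x" and r: "0 < r" and L0: "0 \<le> L"
  obtains M where "0 < M"
    "\<And>H h x x' D c M'. \<lbrakk>\<And>y. y \<in> ball z r \<Longrightarrow> GDERIV H y :> h y; L-lipschitz_on (ball z r) h;
        norm (h x) \<le> B; x \<in> ball z (r / 2); \<phi> x \<le> ereal C; prox_operator M M' D;
        is_arg_min (prox_model \<phi> D (h x) x) (\<lambda>_. True) x'; c \<le> c_max\<rbrakk>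
      \<Longrightarrow> ereal (H x') + \<phi> x' \<le> ereal (H x) + \<phi> x - ereal (c / 2 * (norm (x' - x))\<^sup>2)"
proof -
  define C1 where "C1 = \<bar>C - b\<bar> + norm a * (norm z + r)"
  define B1 where "B1 = norm a + \<bar>B\<bar>"
  \<comment> \<open>The first entry excludes trial points at distance \<open>r / 2\<close> or more,
    given the bound \<open>M / 2 * (norm d)\<^sup>2 \<le> C1 + B1 * norm d\<close> below. The second
    lets the quadratic term absorb the linearization error of \<open>H\<close> and the required
    decrease. The third makes \<open>M\<close> positive.\<close>
  define M where "M = Max {4 / r * (2 * C1 / r + B1) + 1, 2 * L + c_max, 1}"
  have M1: "4 / r * (2 * C1 / r + B1) < M" and M2: "2 * L + c_max \<le> M" and M0: "0 < M"
    by (auto simp: M_def less_max_iff_disj)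
  have C1: "0 \<le> C1" using r by (auto simp: C1_def)
  show ?thesis
  proof (rule that[OF M0])
    fix H h x x' D c M'
    assume der: "\<And>y. y \<in> ball z r \<Longrightarrow> GDERIV H y :> h y" and lip: "L-lipschitz_on (ball z r) h"
      and hB: "norm (h x) \<le> B" and x: "x \<in> ball z (r / 2)" and phix: "\<phi> x \<le> ereal C"
      and D: "prox_operator M M' D" and min: "is_arg_min (prox_model \<phi> D (h x) x) (\<lambda>_. True) x'"
      and c: "c \<le> c_max"
    define d where "d = x' - x"
    have Dd: "M * (norm d)\<^sup>2 \<le> D d \<bullet> d" using D by (auto simp: prox_operator_def)
    have D0: "D 0 = 0" using D by (auto simp: prox_operator_def linear_0)
    have le: "\<phi> x' + ereal (h x \<bullet> d + D d \<bullet> d / 2) \<le> \<phi> x"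
      using prox_model_argmin_le[OF min, of x] by (simp add: d_def D0)
    obtain p where p: "\<phi> x = ereal p"
      using phix minor[of x] by (cases "\<phi> x") auto
    obtain p' where p': "\<phi> x' = ereal p'"
      using le minor[of x'] p by (cases "\<phi> x'") auto
    have le': "p' + h x \<bullet> d + M / 2 * (norm d)\<^sup>2 \<le> p" using le Dd by (simp add: p p')
    have x': "x' = x + d" by (simp add: d_def)
    have zx: "dist z x < r / 2" using x by simp
    then have nx: "norm x \<le> norm z + r" using r norm_triangle_ineq2[of x z] by (simp add: dist_norm norm_minus_commute)
    have "M / 2 * (norm d)\<^sup>2 \<le> C1 + B1 * norm d"
    proof -
      have "a \<bullet> x + a \<bullet> d + b \<le> p'" using minor[of x'] unfolding p' by (simp add: x' inner_add_right)
      moreover have "\<bar>a \<bullet> x\<bar> \<le> norm a * (norm z + r)"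
        using Cauchy_Schwarz_ineq2[of a x] nx by (meson mult_left_mono norm_ge_zero order_trans)
      moreover have "\<bar>a \<bullet> d\<bar> \<le> norm a * norm d" by (rule Cauchy_Schwarz_ineq2)
      moreover have "\<bar>h x \<bullet> d\<bar> \<le> \<bar>B\<bar> * norm d"
        using Cauchy_Schwarz_ineq2[of "h x" d] hB
        by (meson abs_ge_self mult_right_mono norm_ge_zero order_trans)
      moreover have "p \<le> C" using phix p by simp
      ultimately show ?thesis using le' abs_ge_self[of "C - b"] unfolding C1_def B1_def distrib_right by linarith
    qed
    \<comment> \<open>For \<open>norm d \<ge> r / 2\<close> every term is comparable to
      \<open>norm d\<close>: the quadratic one is at least \<open>M * r / 4 * norm d\<close>, and
      \<open>C1\<close> is at most \<open>C1 * (2 / r * norm d)\<close>. Cancelling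
      \<open>norm d\<close> contradicts the first entry of \<open>M\<close>.\<close>
    have "norm d < r / 2"
    proof (rule ccontr)
      assume "\<not> ?thesis"
      then have ge: "r / 2 \<le> norm d" by simp
      have "M / 2 * (r / 2 * norm d) \<le> M / 2 * (norm d)\<^sup>2"
        unfolding power2_eq_square using M0 ge by (intro mult_left_mono mult_right_mono) auto
      also have "\<dots> \<le> C1 * 1 + B1 * norm d" using \<open>M / 2 * (norm d)\<^sup>2 \<le> _\<close> by simp
      also have "C1 * 1 \<le> C1 * (2 / r * norm d)"
        using C1 ge r by (intro mult_left_mono) (auto simp: field_simps)
      finally have "(M * r / 4) * norm d \<le> (2 * C1 / r + B1) * norm d"
        by (simp add: algebra_simps)
      moreover have "0 < norm d" using ge r by linarith
      ultimately have "M * r / 4 \<le> 2 * C1 / r + B1" by (rule mult_right_le_imp_le)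
      moreover have "2 * C1 / r + B1 < M * r / 4" using M1 r by (simp add: field_simps)
      ultimately show False by simp
    qed
    have seg: "x + t *\<^sub>R d \<in> ball z r" if "0 \<le> t" "t \<le> 1" for t
    proof -
      have "dist z (x + t *\<^sub>R d) \<le> dist z x + norm (t *\<^sub>R d)"
        by (metis dist_triangle dist_add_cancel2 dist_norm add.commute add_diff_cancel_left' norm_minus_commute add_diff_cancel_right')
      also have "norm (t *\<^sub>R d) \<le> norm d" using that by (simp add: mult_left_le_one_le)
      finally show ?thesis using zx \<open>norm d < r / 2\<close> by simp
    qed
    \<comment> \<open>The mean value theorem on the segment bounds the linearization error by
      \<open>L * (norm d)\<^sup>2\<close>; the missing factor 1/2 is why \<open>M\<close> contains
      \<open>2 * L\<close>.\<close>
    have "\<exists>t\<in>{0<..<1}. H (x + 1 *\<^sub>R d) - H (x + 0 *\<^sub>R d) = (1 - 0) * (d \<bullet> h (x + t *\<^sub>R d))"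
    proof -
      have "((\<lambda>t. H (x + t *\<^sub>R d)) has_derivative (\<lambda>s. s * (d \<bullet> h (x + t *\<^sub>R d)))) (at t)"
        if "0 \<le> t" "t \<le> 1" for t
      proof -
        have "(H has_derivative (\<lambda>e. e \<bullet> h (x + t *\<^sub>R d))) (at (x + t *\<^sub>R d))"
          using der[OF seg[OF that]] by (simp add: gderiv_def)
        moreover have "((\<lambda>t. x + t *\<^sub>R d) has_derivative (\<lambda>s. s *\<^sub>R d)) (at t)"
          by (auto intro!: derivative_eq_intros)
        ultimately have "((\<lambda>t. H (x + t *\<^sub>R d)) has_derivative (\<lambda>s. (s *\<^sub>R d) \<bullet> h (x + t *\<^sub>R d))) (at t)"
          by (rule has_derivative_compose[rotated])
        then show ?thesis by simp
      qed
      then show ?thesis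
        using mvt_simple[of 0 1 "\<lambda>t. H (x + t *\<^sub>R d)" "\<lambda>t s. s * (d \<bullet> h (x + t *\<^sub>R d))"]
        by (auto intro: has_derivative_at_withinI)
    qed
    then obtain t where t: "0 < t" "t < 1" and Ht: "H x' - H x = d \<bullet> h (x + t *\<^sub>R d)"
      by (auto simp: x')
    have "norm (h (x + t *\<^sub>R d) - h x) \<le> L * norm (x + t *\<^sub>R d - x)"
      using lipschitz_on_normD[OF lip seg[of t] seg[of 0]] t by simp
    also have "\<dots> \<le> L * norm d" using t L0 by (intro mult_left_mono) (auto simp: mult_left_le_one_le)
    finally have hh: "norm (h (x + t *\<^sub>R d) - h x) \<le> L * norm d" .
    have "d \<bullet> (h (x + t *\<^sub>R d) - h x) \<le> norm d * norm (h (x + t *\<^sub>R d) - h x)"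
      by (rule norm_cauchy_schwarz)
    also have "\<dots> \<le> norm d * (L * norm d)" by (intro mult_left_mono hh) auto
    finally have "H x' \<le> H x + h x \<bullet> d + L * (norm d)\<^sup>2"
      using Ht by (simp add: inner_diff_right inner_commute power2_eq_square algebra_simps)
    moreover have "(2 * L + c) * (norm d)\<^sup>2 \<le> M * (norm d)\<^sup>2"
      using M2 c by (intro mult_right_mono) auto
    ultimately have "H x' + p' \<le> H x + p - c / 2 * (norm d)\<^sup>2"
      using le' by (simp add: algebra_simps)
    then show "ereal (H x') + \<phi> x' \<le> ereal (H x) + \<phi> x - ereal (c / 2 * (norm (x' - x))\<^sup>2)"
      by (simp add: p p' d_def)
  qed
qed

text \<open>Either the first trial is accepted, with bound \<open>\<iota>_hi\<close>, or trial
  \<open>N - 1\<close> was rejected. Trial \<open>l\<close> carries the factor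
  \<open>\<rho> ^ (l - 1)\<close>, so rejection forces
  \<open>\<rho> ^ (N - 2) * \<iota>_lo < M\<close>; one more factor \<open>\<rho>\<close> and the
  ratio \<open>\<iota>_hi / \<iota>_lo\<close> give the second entry of the maximum.\<close>

lemma prox_step_bounded_operator:
  assumes step: "prox_step \<phi> H \<rho> D g c x x'" and D: "prox_operator \<iota>_lo \<iota>_hi D"
    and pos: "0 < \<iota>_lo" "0 \<le> \<iota>_hi" "1 < \<rho>" "0 < M"
    and accept: "\<And>p D M'. prox_operator M M' D \<Longrightarrow> is_arg_min (prox_model \<phi> D g x) (\<lambda>_. True) p
      \<Longrightarrow> ereal (H p) + \<phi> p \<le> ereal (H x) + \<phi> x - ereal (c / 2 * (norm (p - x))\<^sup>2)"
  obtains m D' where "prox_operator m (max \<iota>_hi (\<rho> * M * \<iota>_hi / \<iota>_lo)) D'"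
    "is_arg_min (prox_model \<phi> D' g x) (\<lambda>_. True) x'"
proof -
  obtain N t where N: "1 \<le> N"
    and trial: "\<And>l. l \<in> {1..N} \<Longrightarrow>
      is_arg_min (prox_model \<phi> (\<lambda>d. \<rho> ^ (l - 1) *\<^sub>R D d) g x) (\<lambda>_. True) (t l)"
    and rej: "\<And>l. l \<in> {1..<N} \<Longrightarrow> \<not> (ereal (H (t l)) + \<phi> (t l)
       \<le> ereal (H x) + \<phi> x - ereal (c / 2 * (norm (t l - x))\<^sup>2))"
    and x': "x' = t N"
    using step unfolding prox_step_def backtracking_def by blast
  have op: "prox_operator (\<rho> ^ l * \<iota>_lo) (\<rho> ^ l * \<iota>_hi) (\<lambda>d. \<rho> ^ l *\<^sub>R D d)" for l
    using prox_operator_scaleR[OF D] pos by simp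
  have weaken: "prox_operator m' M2 D'" if "prox_operator m M1 D'" "m' \<le> m" "M1 \<le> M2" for m m' M1 M2 and D' :: "'a \<Rightarrow> 'a"
    using that unfolding prox_operator_def
    by (meson mult_right_mono norm_ge_zero order_trans zero_le_power2)
  have "\<rho> ^ (N - 1) * \<iota>_hi \<le> max \<iota>_hi (\<rho> * M * \<iota>_hi / \<iota>_lo)"
  proof (cases "N = 1")
    case False
    then have l: "N - 1 \<in> {1..<N}" using N by auto
    have "\<rho> ^ (N - 1 - 1) * \<iota>_lo < M"
    proof (rule ccontr)
      assume "\<not> ?thesis"
      then have "prox_operator M (\<rho> ^ (N - 1 - 1) * \<iota>_hi) (\<lambda>d. \<rho> ^ (N - 1 - 1) *\<^sub>R D d)"
        using op[of "N - 1 - 1"] by (auto intro: weaken)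
      from accept[OF this trial] rej[OF l] l show False by auto
    qed
    then have "\<rho> * \<rho> ^ (N - 1 - 1) * \<iota>_lo * \<iota>_hi \<le> \<rho> * M * \<iota>_hi"
      using pos by (intro mult_right_mono) (auto simp: mult.assoc)
    moreover have "\<rho> ^ (N - 1) = \<rho> * \<rho> ^ (N - 1 - 1)"
      using l by (metis Suc_diff_1 atLeastLessThan_iff less_le_trans power_Suc zero_less_one)
    ultimately have "\<rho> ^ (N - 1) * \<iota>_hi \<le> \<rho> * M * \<iota>_hi / \<iota>_lo"
      using pos by (simp add: field_simps)
    then show ?thesis by simp
  qed simp
  then show ?thesis using that weaken[OF op[of "N - 1"] order_refl] trial[of N] N x' by auto
qed

text \<open>Treats one block along a subsequence. \<open>H\<close> and \<open>h\<close> depend on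
  \<open>j\<close> because the other block is frozen at varying values, whereas \<open>L\<close>,
  \<open>B\<close> and \<open>C\<close> do not; this uniformity yields one constant \<open>K\<close>
  for all minorants. The error \<open>e j\<close> is the accepted operator applied to the
  step.\<close>

lemma prox_step_convergence:
  fixes \<phi> :: "'a::real_inner \<Rightarrow> ereal"
  assumes minor: "\<And>x. ereal (a \<bullet> x + b) \<le> \<phi> x"
    and lsc: "\<And>ys. ys \<longlonglongrightarrow> z \<Longrightarrow> \<phi> z \<le> liminf (\<lambda>j. \<phi> (ys j))"
    and xs: "xs \<longlonglongrightarrow> z" and xs': "xs' \<longlonglongrightarrow> z"
    and C: "\<And>j. \<phi> (xs j) \<le> ereal C" and ball: "\<And>j. xs j \<in> ball z (r / 2)" and r: "0 < r"
    and der: "\<And>j y. y \<in> ball z r \<Longrightarrow> GDERIV (H j) y :> h j y"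
    and lip: "\<And>j. L-lipschitz_on (ball z r) (h j)"
    and B: "\<And>j. norm (h j (xs j)) \<le> B"
    and step: "\<And>j. prox_step \<phi> (H j) \<rho> (D j) (h j (xs j)) (c j) (xs j) (xs' j)"
    and D: "\<And>j. prox_operator \<iota>_lo \<iota>_hi (D j)" and c: "\<And>j. c j \<le> c_max"
    and pos: "0 < \<iota>_lo" "0 \<le> \<iota>_hi" "1 < \<rho>"
  obtains p pz e K where "\<phi> z = ereal pz" "\<And>j. \<phi> (xs' j) = ereal (p j)" "p \<longlonglongrightarrow> pz" "e \<longlonglongrightarrow> 0"
    "\<And>j y. ereal (p j - (h j (xs j) + e j) \<bullet> (y - xs' j) - K * (norm (y - xs' j))\<^sup>2) \<le> \<phi> y"
proof (rule large_quadratic_term_accepted[OF minor r lipschitz_on_nonneg[OF lip],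
      where z = z and B = B and C = C and c_max = c_max])
  fix M
  assume M: "0 < M" and acc: "\<And>H h x x' D c M'. \<lbrakk>\<And>y. y \<in> ball z r \<Longrightarrow> GDERIV H y :> h y;
      L-lipschitz_on (ball z r) h; norm (h x) \<le> B; x \<in> ball z (r / 2); \<phi> x \<le> ereal C;
      prox_operator M M' D; is_arg_min (prox_model \<phi> D (h x) x) (\<lambda>_. True) x'; c \<le> c_max\<rbrakk>
      \<Longrightarrow> ereal (H x') + \<phi> x' \<le> ereal (H x) + \<phi> x - ereal (c / 2 * (norm (x' - x))\<^sup>2)"
  \<comment> \<open>\<open>M\<close> was obtained before any index \<open>j\<close> was fixed, so
    \<open>K\<close> bounds all accepted operators at once.\<close>
  define K where "K = max \<iota>_hi (\<rho> * M * \<iota>_hi / \<iota>_lo)"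
  have K0: "0 \<le> K" using pos by (simp add: K_def)
  have "\<exists>m D'. prox_operator m K D' \<and> is_arg_min (prox_model \<phi> D' (h j (xs j)) (xs j)) (\<lambda>_. True) (xs' j)" for j
    unfolding K_def
    by (rule prox_step_bounded_operator[OF step D pos M acc[OF der lip B ball C _ _ c]]) auto
  then obtain m D' where op: "\<And>j. prox_operator (m j) K (D' j)"
    and min: "\<And>j. is_arg_min (prox_model \<phi> (D' j) (h j (xs j)) (xs j)) (\<lambda>_. True) (xs' j)"
    by metis
  define q where "q j y = h j (xs j) \<bullet> (y - xs j) + D' j (y - xs j) \<bullet> (y - xs j) / 2" for j y
  have le: "\<phi> (xs' j) + ereal (q j (xs' j)) \<le> \<phi> y + ereal (q j y)" for j y
    unfolding q_def by (rule prox_model_argmin_le[OF min])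
  have opD: "norm (D' j y) \<le> K * norm y" and linD: "linear (D' j)" for j y
    using op[of j] by (auto simp: prox_operator_def)
  have fin: "\<exists>t. \<phi> (xs' j) = ereal t" for j
  proof -
    have "q j (xs j) = 0" using linD[of j] by (simp add: q_def linear_0)
    then have "\<phi> (xs' j) + ereal (q j (xs' j)) \<le> ereal C" using le[of j "xs j"] C[of j] by simp
    then show ?thesis using minor[of "xs' j"] by (cases "\<phi> (xs' j)") auto
  qed
  then obtain p where p: "\<And>j. \<phi> (xs' j) = ereal (p j)" by metis
  \<comment> \<open>Finiteness at the limit is derived from lower semicontinuity and the uniform
    bound \<open>C\<close>. It makes \<open>z\<close> a usable competitor in the
    subproblems.\<close>
  have "\<phi> z \<le> liminf (\<lambda>j. \<phi> (xs j))" by (rule lsc[OF xs])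
  also have "\<dots> \<le> liminf (\<lambda>j. ereal C)" by (rule Liminf_mono) (simp add: C)
  also have "\<dots> = ereal C" by (simp add: Liminf_const)
  finally obtain pz where pz: "\<phi> z = ereal pz" using minor[of z] by (cases "\<phi> z") auto
  \<comment> \<open>The smooth part of the model vanishes along every sequence with limit
    \<open>z\<close>, by the uniform bounds \<open>B\<close> and \<open>K\<close>. It is applied to
    the competitor \<open>z\<close> itself and to the new iterates.\<close>
  have q0: "(\<lambda>j. q j (ys j)) \<longlonglongrightarrow> 0" if "ys \<longlonglongrightarrow> z" for ys
  proof (rule Lim_null_comparison)
    have d: "(\<lambda>j. norm (ys j - xs j)) \<longlonglongrightarrow> 0"
      using tendsto_diff[OF that xs] by (simp add: tendsto_norm_zero)
    have "(\<lambda>j. B * norm (ys j - xs j) + K * norm (ys j - xs j) * norm (ys j - xs j) / 2)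
        \<longlonglongrightarrow> B * 0 + K * 0 * 0 / 2"
      by (intro tendsto_add tendsto_mult tendsto_divide tendsto_const d) simp
    then show "(\<lambda>j. B * norm (ys j - xs j) + K * norm (ys j - xs j) * norm (ys j - xs j) / 2) \<longlonglongrightarrow> 0"
      by simp
    show "\<forall>\<^sub>F j in sequentially. norm (q j (ys j))
        \<le> B * norm (ys j - xs j) + K * norm (ys j - xs j) * norm (ys j - xs j) / 2"
    proof (intro always_eventually allI)
      fix j
      have "\<bar>h j (xs j) \<bullet> (ys j - xs j)\<bar> \<le> B * norm (ys j - xs j)"
        using Cauchy_Schwarz_ineq2 B by (meson mult_right_mono norm_ge_zero order_trans)
      moreover have "\<bar>D' j (ys j - xs j) \<bullet> (ys j - xs j)\<bar> \<le> K * norm (ys j - xs j) * norm (ys j - xs j)"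
        using Cauchy_Schwarz_ineq2 opD by (meson mult_right_mono norm_ge_zero order_trans)
      ultimately show "norm (q j (ys j))
        \<le> B * norm (ys j - xs j) + K * norm (ys j - xs j) * norm (ys j - xs j) / 2"
        unfolding q_def real_norm_def by linarith
    qed
  qed
  have "p \<longlonglongrightarrow> pz"
  proof -
    have up: "p j \<le> pz + (q j z - q j (xs' j))" for j using le[of j z] by (simp add: p pz)
    have lim: "(\<lambda>j. pz + (q j z - q j (xs' j))) \<longlonglongrightarrow> pz"
      using tendsto_add[OF tendsto_const tendsto_diff[OF q0[of "\<lambda>_. z"] q0[OF xs']]] by simp
    have "(\<lambda>j. ereal (p j)) \<longlonglongrightarrow> ereal pz"
    proof (rule order_tendstoI)
      fix t assume "t < ereal pz"
      then show "\<forall>\<^sub>F j in sequentially. t < ereal (p j)"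
        using lsc[OF xs'] unfolding le_Liminf_iff p pz by blast
    next
      fix t assume t: "ereal pz < t"
      have "(\<lambda>j. ereal (pz + (q j z - q j (xs' j)))) \<longlonglongrightarrow> ereal pz" using lim by simp
      from order_tendstoD(2)[OF this t]
      show "\<forall>\<^sub>F j in sequentially. ereal (p j) < t"
        by eventually_elim (metis up ereal_less_eq(3) le_less_trans)
    qed
    then show ?thesis by simp
  qed
  moreover have "(\<lambda>j. D' j (xs' j - xs j)) \<longlonglongrightarrow> 0"
  proof (rule Lim_null_comparison)
    show "\<forall>\<^sub>F j in sequentially. norm (D' j (xs' j - xs j)) \<le> K * norm (xs' j - xs j)"
      using opD by simp
    have "(\<lambda>j. xs' j - xs j) \<longlonglongrightarrow> 0" using tendsto_diff[OF xs' xs] by simp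
    then show "(\<lambda>j. K * norm (xs' j - xs j)) \<longlonglongrightarrow> 0"
      by (intro tendsto_mult_right_zero tendsto_norm_zero)
  qed
  ultimately show ?thesis
    using that[OF pz p] prox_model_argmin_minorant[OF op min p] by blast
qed


section \<open>Subgradients and local Lipschitz continuity\<close>

text \<open>The difference quotient is bounded below by \<open>R\<close>, the normalized Taylor
  remainder of \<open>F\<close> minus \<open>K * norm (y - z)\<close>; both parts tend to 0.\<close>

lemma regular_subdifferential_smooth_plus_quadratic_minorant:
  fixes F :: "'a::real_inner \<Rightarrow> real"
  assumes grad: "GDERIV F z :> g" and fin: "\<Phi> z = ereal p"
    and minor: "\<And>y. ereal (p + v \<bullet> (y - z) - K * (norm (y - z))\<^sup>2) \<le> \<Phi> y"
  shows "g + v \<in> regular_subdifferential (\<lambda>y. ereal (F y) + \<Phi> y) z"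
proof -
  define G where "G = (\<lambda>y. ereal (F y) + \<Phi> y)"
  define R where "R y = (F y - F z - (y - z) \<bullet> g) / norm (y - z) - K * norm (y - z)" for y
  have "((\<lambda>y. norm (F y - F z - (y - z) \<bullet> g) / norm (y - z)) \<longlongrightarrow> 0) (at z)"
    using grad by (simp add: gderiv_def has_derivative_iff_norm)
  then have "((\<lambda>y. norm ((F y - F z - (y - z) \<bullet> g) / norm (y - z))) \<longlongrightarrow> 0) (at z)"
    by simp
  then have q: "((\<lambda>y. (F y - F z - (y - z) \<bullet> g) / norm (y - z)) \<longlongrightarrow> 0) (at z)"
    by (rule tendsto_norm_zero_cancel)
  have "((\<lambda>y. K * norm (y - z)) \<longlongrightarrow> 0) (at z)"
    by (auto intro!: tendsto_eq_intros)
  from tendsto_diff[OF q this] have "(R \<longlongrightarrow> 0) (at z)" by (simp add: R_def[abs_def])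
  then have R: "((\<lambda>y. ereal (R y)) \<longlongrightarrow> ereal 0) (at z)" by simp
  have "ereal (R y) \<le> (G y - G z - ereal ((g + v) \<bullet> (y - z))) / ereal (norm (y - z))"
    if "y \<noteq> z" for y
  proof -
    have n: "0 < norm (y - z)" using that by simp
    show ?thesis
    proof (cases "\<Phi> y")
      case (real t)
      then have "p + v \<bullet> (y - z) - K * (norm (y - z))\<^sup>2 \<le> t" using minor[of y] by simp
      then have "F y - F z - (y - z) \<bullet> g - K * (norm (y - z))\<^sup>2 \<le> F y + t - (F z + p) - (g + v) \<bullet> (y - z)"
        by (simp add: inner_add_left inner_commute[of _ g])
      then have "(F y - F z - (y - z) \<bullet> g - K * (norm (y - z))\<^sup>2) / norm (y - z)
          \<le> (F y + t - (F z + p) - (g + v) \<bullet> (y - z)) / norm (y - z)"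
        using n by (simp add: divide_right_mono)
      moreover have "R y = (F y - F z - (y - z) \<bullet> g - K * (norm (y - z))\<^sup>2) / norm (y - z)"
        using n by (simp add: R_def diff_divide_distrib power2_eq_square)
      ultimately show ?thesis using real fin n by (simp add: G_def)
    next
      case PInf
      then show ?thesis using fin n by (simp add: G_def)
    next
      case MInf
      then show ?thesis using minor[of y] by simp
    qed
  qed
  then have "\<forall>\<^sub>F y in at z. ereal (R y) \<le> (G y - G z - ereal ((g + v) \<bullet> (y - z))) / ereal (norm (y - z))"
    by (simp add: eventually_at_filter)
  then have "Liminf (at z) (\<lambda>y. ereal (R y))
      \<le> Liminf (at z) (\<lambda>y. (G y - G z - ereal ((g + v) \<bullet> (y - z))) / ereal (norm (y - z)))"
    by (rule Liminf_mono)
  moreover have "0 \<le> Liminf (at z) (\<lambda>y. ereal (R y))"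
  \<comment> \<open>In a trivial space \<open>z\<close> is isolated; the Liminf over the trivial
    filter is then the top element.\<close>
  proof (cases "at z = bot")
    case False
    then show ?thesis using lim_imp_Liminf[OF False R] by simp
  qed simp
  ultimately have "0 \<le> Liminf (at z) (\<lambda>y. (G y - G z - ereal ((g + v) \<bullet> (y - z))) / ereal (norm (y - z)))"
    by (rule order_trans[rotated])
  then show ?thesis unfolding regular_subdifferential_def G_def[symmetric]
    using fin by (simp add: G_def)
qed

text \<open>\<open>lsc_fun\<close> speaks of the punctured filter \<open>at x\<close>, while a
  sequence may visit \<open>x\<close>. There the strict bound \<open>y < h x\<close> holds anyway,
  so it extends to \<open>nhds x\<close>.\<close>

lemma lsc_fun_liminf:
  fixes h :: "'a::topological_space \<Rightarrow> ereal"
  assumes "lsc_fun h" "xs \<longlonglongrightarrow> x"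
  shows "h x \<le> liminf (\<lambda>j. h (xs j))"
  unfolding le_Liminf_iff
proof (intro allI impI)
  fix y assume y: "y < h x"
  then have "\<forall>\<^sub>F t in at x. y < h t"
    using assms(1) unfolding lsc_fun_def le_Liminf_iff by blast
  then have "\<forall>\<^sub>F t in nhds x. y < h t"
    unfolding eventually_at_filter by (rule eventually_mono) (use y in auto)
  then show "\<forall>\<^sub>F j in sequentially. y < h (xs j)"
    using assms(2) unfolding filterlim_iff by blast
qed

section \<open>Calculus of locally Lipschitz maps\<close>

lemma locally_lipschitz_compose:
  fixes g :: "'b::metric_space \<Rightarrow> 'c::metric_space" and f :: "'a::metric_space \<Rightarrow> 'b"
  assumes "locally_lipschitz g" "locally_lipschitz f"
  shows "locally_lipschitz (\<lambda>x. g (f x))"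
  unfolding locally_lipschitz_def
proof
  fix x
  obtain r L where r: "0 < r" and L: "L-lipschitz_on (ball x r) f"
    using assms(2) unfolding locally_lipschitz_def by blast
  obtain s M where s: "0 < s" and M: "M-lipschitz_on (ball (f x) s) g"
    using assms(1) unfolding locally_lipschitz_def by blast
  have L0: "0 \<le> L" by (rule lipschitz_on_nonneg[OF L])
  \<comment> \<open>The second entry maps the ball into \<open>ball (f x) s\<close>; the summand 1
    avoids division by zero for \<open>L = 0\<close>.\<close>
  define t where "t = min r (s / (L + 1))"
  have t: "0 < t" using r s L0 by (simp add: t_def)
  have Lt: "L-lipschitz_on (ball x t) f" by (rule lipschitz_on_subset[OF L]) (auto simp: t_def)
  have "f ` ball x t \<subseteq> ball (f x) s"
  proof
    fix w assume "w \<in> f ` ball x t"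
    then obtain y where y: "y \<in> ball x t" "w = f y" by blast
    have "dist (f x) (f y) \<le> L * dist x y" using lipschitz_onD[OF Lt] t y by simp
    also have "\<dots> \<le> (L + 1) * dist x y" by (intro mult_right_mono) auto
    also have "\<dots> < (L + 1) * (s / (L + 1))" using y L0 by (intro mult_strict_left_mono) (auto simp: t_def)
    also have "\<dots> = s" using L0 by simp
    finally show "w \<in> ball (f x) s" using y by simp
  qed
  then have "(M * L)-lipschitz_on (ball x t) (\<lambda>x. g (f x))"
    by (intro lipschitz_on_compose2[OF Lt] lipschitz_on_subset[OF M])
  with t show "\<exists>r>0. \<exists>L. L-lipschitz_on (ball x r) (\<lambda>x. g (f x))" by blast
qed

lemma locally_lipschitz_Pair:
  assumes "locally_lipschitz f" "locally_lipschitz g"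
  shows "locally_lipschitz (\<lambda>x. (f x, g x))"
  unfolding locally_lipschitz_def
proof
  fix x
  obtain r L where r: "0 < r" and L: "L-lipschitz_on (ball x r) f"
    using assms(1) unfolding locally_lipschitz_def by blast
  obtain s M where s: "0 < s" and M: "M-lipschitz_on (ball x s) g"
    using assms(2) unfolding locally_lipschitz_def by blast
  have "(sqrt (L\<^sup>2 + M\<^sup>2))-lipschitz_on (ball x (min r s)) (\<lambda>x. (f x, g x))"
    by (intro lipschitz_on_Pair lipschitz_on_subset[OF L] lipschitz_on_subset[OF M]) auto
  with r s show "\<exists>r>0. \<exists>L. L-lipschitz_on (ball x r) (\<lambda>x. (f x, g x))"
    by (intro exI[of _ "min r s"]) auto
qed

lemma locally_lipschitz_bounded_linear:
  assumes "bounded_linear f"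
  shows "locally_lipschitz f"
  unfolding locally_lipschitz_def
proof
  fix x
  obtain L where "L-lipschitz_on (ball x 1) f" using bounded_linear.lipschitz_boundE[OF assms] .
  then show "\<exists>r>0. \<exists>L. L-lipschitz_on (ball x r) f" by (intro exI[of _ 1]) auto
qed

text \<open>Changing one factor at a time leaves the other factor as a coefficient, which
  \<open>N\<close> bounds on the unit ball around \<open>z\<close>. The constant grows with
  \<open>norm z\<close>, so the conclusion is local.\<close>

lemma (in bounded_bilinear) locally_lipschitz: "locally_lipschitz (\<lambda>z. prod (fst z) (snd z))"
  unfolding locally_lipschitz_def
proof
  fix z :: "'a \<times> 'b"
  obtain K where K: "0 < K" and bd: "\<And>a b. norm (prod a b) \<le> norm a * norm b * K"
    using pos_bounded by blast
  define N where "N = norm z + 1"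
  have "(2 * K * N)-lipschitz_on (ball z 1) (\<lambda>z. prod (fst z) (snd z))"
  proof (rule lipschitz_onI)
    fix x y assume xy: "x \<in> ball z 1" "y \<in> ball z 1"
    have N: "norm x \<le> N" "norm y \<le> N"
      using xy norm_triangle_ineq2[of x z] norm_triangle_ineq2[of y z]
      by (auto simp: N_def dist_norm norm_minus_commute)
    have nonneg: "0 \<le> N" by (simp add: N_def)
    have nf: "norm (fst w) \<le> norm w" "norm (snd w) \<le> norm w" for w :: "'a \<times> 'b"
      by (metis norm_fst_le norm_snd_le prod.collapse)+
    have N1: "norm (fst (x - y)) \<le> norm (x - y)" "norm (snd (x - y)) \<le> norm (x - y)"
      "norm (snd x) \<le> N" "norm (fst y) \<le> N"
      using nf order_trans[OF nf(2) N(1)] order_trans[OF nf(1) N(2)] by blast+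
    have "prod (fst x) (snd x) - prod (fst y) (snd y)
        = prod (fst (x - y)) (snd x) + prod (fst y) (snd (x - y))"
      by (simp add: diff_left diff_right)
    also have "norm \<dots> \<le> norm (fst (x - y)) * norm (snd x) * K + norm (fst y) * norm (snd (x - y)) * K"
      by (intro norm_triangle_le add_mono bd)
    also have "\<dots> \<le> norm (x - y) * N * K + N * norm (x - y) * K"
      by (intro add_mono mult_right_mono mult_mono nonneg N1) (use K in auto)
    finally show "dist (prod (fst x) (snd x)) (prod (fst y) (snd y)) \<le> 2 * K * N * dist x y"
      by (simp add: dist_norm algebra_simps)
  qed (use K in \<open>simp add: N_def\<close>)
  then show "\<exists>r>0. \<exists>L. L-lipschitz_on (ball z r) (\<lambda>z. prod (fst z) (snd z))"
    by (intro exI[of _ 1]) auto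
qed

text \<open>\<open>gradient\<close> is a definite description, so existence has to be supplied: in a
  Euclidean space \<open>adjoint f' 1\<close> is the Riesz representative of the derivative.\<close>

lemma gderiv_gradient:
  fixes f :: "'a::euclidean_space \<Rightarrow> real"
  assumes "f differentiable (at x)"
  shows "GDERIV f x :> gradient f x"
proof -
  obtain f' where f': "(f has_derivative f') (at x)" using assms by (auto simp: differentiable_def)
  then have "linear f'" by (rule has_derivative_linear)
  then have "f' = (\<lambda>h. h \<bullet> adjoint f' 1)" by (simp add: adjoint_works)
  then have "GDERIV f x :> adjoint f' 1" unfolding gderiv_def using f' by metis
  then show ?thesis using gradient_eqI by metis
qed

section \<open>Alternating steps on two blocks\<close>

lemma prox_step_descent:
  "prox_step \<phi> H \<rho> D g c x x' \<Longrightarrow>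
    ereal (H x') + \<phi> x' \<le> ereal (H x) + \<phi> x - ereal (c / 2 * (norm (x' - x))\<^sup>2)"
  unfolding prox_step_def backtracking_def by blast

text \<open>A monotone bounded sequence converges, so its consecutive differences form a null
  sequence, and they dominate \<open>c * (\<delta> k)\<^sup>2\<close>.\<close>

lemma norm_steps_tendsto_0:
  fixes \<gamma> \<delta> :: "nat \<Rightarrow> real"
  assumes dec: "\<And>k. \<gamma> (Suc k) \<le> \<gamma> k - c * (\<delta> k)\<^sup>2" and bdd: "\<And>k. lb \<le> \<gamma> k" and c: "0 < c"
  shows "\<delta> \<longlonglongrightarrow> 0"
proof -
  have "decseq \<gamma>"
  proof (rule decseq_SucI)
    fix k
    have "0 \<le> c * (\<delta> k)\<^sup>2" using c by simp
    then show "\<gamma> (Suc k) \<le> \<gamma> k" using dec[of k] by linarith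
  qed
  then obtain l where l: "\<gamma> \<longlonglongrightarrow> l" using decseq_convergent[of \<gamma> lb] bdd by blast
  then have "(\<lambda>k. (\<gamma> k - \<gamma> (Suc k)) / c) \<longlonglongrightarrow> (l - l) / c"
    using c by (intro tendsto_intros LIMSEQ_Suc) auto
  from tendsto_real_sqrt[OF this] have "(\<lambda>k. sqrt ((\<gamma> k - \<gamma> (Suc k)) / c)) \<longlonglongrightarrow> 0"
    by simp
  moreover have "norm (\<delta> k) \<le> sqrt ((\<gamma> k - \<gamma> (Suc k)) / c)" for k
  proof -
    have "(\<delta> k)\<^sup>2 \<le> (\<gamma> k - \<gamma> (Suc k)) / c" using dec[of k] c by (simp add: field_simps)
    then show ?thesis using real_le_rsqrt[of "\<bar>\<delta> k\<bar>"] by simp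
  qed
  ultimately show ?thesis by (rule Lim_null_comparison[OF always_eventually[OF allI], rotated])
qed

lemma convergent_imp_bounded_above:
  fixes q :: "nat \<Rightarrow> real"
  assumes "q \<longlonglongrightarrow> l"
  obtains C where "\<And>j. q j \<le> C"
proof -
  from convergent_imp_Bseq[OF convergentI[OF assms]]
  obtain C where "\<And>j. norm (q j) \<le> C" unfolding Bseq_def by blast
  then show ?thesis using that[of C] order_trans[OF abs_ge_self] unfolding real_norm_def by blast
qed

lemma locally_lipschitz_tendsto:
  assumes "locally_lipschitz g" "xs \<longlonglongrightarrow> x"
  shows "(\<lambda>j. g (xs j)) \<longlonglongrightarrow> g x"
proof -
  obtain r L where r: "0 < r" and L: "L-lipschitz_on (ball x r) g"
    using assms(1) unfolding locally_lipschitz_def by blast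
  have "continuous (at x within ball x r) g"
    using lipschitz_on_continuous_within[OF L] r by simp
  then have "isCont g x" using r at_within_open[of x "ball x r"] by simp
  then show ?thesis using assms(2) by (rule isCont_tendsto_compose)
qed

text \<open>At the new iterate the quadratic minorants of \<open>\<phi>\<close> and
  \<open>\<psi>\<close> add to one for their sum, so the current gradient minus the gradients used
  in the two steps, up to null errors, is a regular subgradient of \<open>G\<close>. All gradients
  involved have the same limit, so this difference tends to 0. \<open>T\<close> regroups the two
  blocks into the triple on which the objective lives.\<close>

theorem alternating_prox_gradient_critical:
  fixes F :: "'a::real_inner \<times> 'b::real_inner \<times> 'c::real_inner \<Rightarrow> real"
    and g :: "'a \<times> 'b \<times> 'c \<Rightarrow> 'a \<times> 'b \<times> 'c"
    and \<phi> :: "'a \<times> 'b \<Rightarrow> ereal" and \<psi> :: "'c \<Rightarrow> ereal" and P :: "nat \<Rightarrow> 'a \<times> 'b"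
  defines "T \<equiv> \<lambda>p s. (fst p, snd p, s)"
  defines "G \<equiv> \<lambda>(x, y, s). ereal (F (x, y, s)) + (\<phi> (x, y) + \<psi> s)"
  defines "g1 \<equiv> \<lambda>z. (fst (g z), fst (snd (g z)))" and "g2 \<equiv> \<lambda>z. snd (snd (g z))"
  assumes grad: "\<And>z. GDERIV F z :> g z" and lipg: "locally_lipschitz g"
    and minor1: "\<And>p. ereal (a1 \<bullet> p + b1) \<le> \<phi> p" and minor2: "\<And>s. ereal (a2 \<bullet> s + b2) \<le> \<psi> s"
    and lsc1: "\<And>ps p. ps \<longlonglongrightarrow> p \<Longrightarrow> \<phi> p \<le> liminf (\<lambda>j. \<phi> (ps j))"
    and lsc2: "\<And>ss s. ss \<longlonglongrightarrow> s \<Longrightarrow> \<psi> s \<le> liminf (\<lambda>j. \<psi> (ss j))"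
    and bdd: "\<And>z. ereal lb \<le> G z" and init: "G (T (P 0) (S 0)) < \<infinity>"
    and step1: "\<And>k. prox_step \<phi> (\<lambda>p. F (T p (S k))) \<rho> (D1 k) (g1 (T (P k) (S k))) (c1 k) (P k) (P (Suc k))"
    and step2: "\<And>k. prox_step \<psi> (\<lambda>s. F (T (P (Suc k)) s)) \<rho> (D2 k) (g2 (T (P (Suc k)) (S k))) (c2 k)
      (S k) (S (Suc k))"
    and D: "\<And>k. prox_operator \<iota>_lo \<iota>_hi (D1 k)" "\<And>k. prox_operator \<iota>_lo \<iota>_hi (D2 k)"
    and c: "\<And>k. c1 k \<in> {c_min..c_max}" "\<And>k. c2 k \<in> {c_min..c_max}"
    and pos: "0 < \<iota>_lo" "0 \<le> \<iota>_hi" "1 < \<rho>" "0 < c_min"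
    and r: "strict_mono r" and lim: "(\<lambda>j. T (P (r j)) (S (r j))) \<longlonglongrightarrow> T p_star s_star"
  shows "0 \<in> limiting_subdifferential G (T p_star s_star)"
proof -
  have GT: "G (T p s) = ereal (F (T p s)) + (\<phi> p + \<psi> s)" for p s
    by (simp add: G_def T_def)
  have distT: "dist (T p s) (T q t) = sqrt ((dist p q)\<^sup>2 + (dist s t)\<^sup>2)" for p q s t
    by (simp add: T_def dist_Pair_Pair dist_prod_def)
  have tendsto_T: "(\<lambda>j. T (ps j) (ss j)) \<longlonglongrightarrow> T p s"
    if "ps \<longlonglongrightarrow> p" "ss \<longlonglongrightarrow> s" for ps ss p s
    unfolding T_def using that by (intro tendsto_intros)
  have contF: "(\<lambda>j. F (zs j)) \<longlonglongrightarrow> F z" if "zs \<longlonglongrightarrow> z" for zs z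
    using has_derivative_continuous[OF grad[unfolded gderiv_def]] that by (rule isCont_tendsto_compose)

  \<comment> \<open>Affine minorants exclude the value \<open>-\<infinity>\<close>, and descent from
    finite values excludes \<open>\<infinity>\<close>; from here on the decrease can be computed in
    the reals.\<close>
  have fin: "\<exists>p s. \<phi> (P k) = ereal p \<and> \<psi> (S k) = ereal s" for k
  proof (induction k)
    case 0
    then show ?case using init minor1[of "P 0"] minor2[of "S 0"] unfolding GT
      by (cases "\<phi> (P 0)"; cases "\<psi> (S 0)") auto
  next
    case (Suc k)
    then obtain p s where ps: "\<phi> (P k) = ereal p" "\<psi> (S k) = ereal s" by blast
    have "\<exists>p. \<phi> (P (Suc k)) = ereal p"
      using prox_step_descent[OF step1[of k]] minor1[of "P (Suc k)"] ps
      by (cases "\<phi> (P (Suc k))") auto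
    moreover have "\<exists>s. \<psi> (S (Suc k)) = ereal s"
      using prox_step_descent[OF step2[of k]] minor2[of "S (Suc k)"] ps
      by (cases "\<psi> (S (Suc k))") auto
    ultimately show ?case by blast
  qed
  define p s where "p k = real_of_ereal (\<phi> (P k))" and "s k = real_of_ereal (\<psi> (S k))" for k
  have p: "\<phi> (P k) = ereal (p k)" and s: "\<psi> (S k) = ereal (s k)" for k
    using fin[of k] by (auto simp: p_def s_def)
  define \<gamma> where "\<gamma> k = F (T (P k) (S k)) + p k + s k" for k
  have \<gamma>: "lb \<le> \<gamma> k" for k using bdd[of "T (P k) (S k)"] unfolding GT p s by (simp add: \<gamma>_def)
  define \<delta>1 \<delta>2 where "\<delta>1 k = norm (P (Suc k) - P k)" and "\<delta>2 k = norm (S (Suc k) - S k)" for k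
  \<comment> \<open>The mixed value \<open>F (T (P (Suc k)) (S k))\<close> ends the first step and
    starts the second, so it cancels.\<close>
  have desc: "\<gamma> (Suc k) \<le> \<gamma> k - c_min / 2 * (\<delta>1 k)\<^sup>2 - c_min / 2 * (\<delta>2 k)\<^sup>2" for k
  proof -
    have "F (T (P (Suc k)) (S k)) + p (Suc k) \<le> F (T (P k) (S k)) + p k - c1 k / 2 * (\<delta>1 k)\<^sup>2"
      using prox_step_descent[OF step1[of k]] by (simp add: p \<delta>1_def)
    moreover have "F (T (P (Suc k)) (S (Suc k))) + s (Suc k)
        \<le> F (T (P (Suc k)) (S k)) + s k - c2 k / 2 * (\<delta>2 k)\<^sup>2"
      using prox_step_descent[OF step2[of k]] by (simp add: s \<delta>2_def)
    moreover have "c_min / 2 * (\<delta>1 k)\<^sup>2 \<le> c1 k / 2 * (\<delta>1 k)\<^sup>2" "c_min / 2 * (\<delta>2 k)\<^sup>2 \<le> c2 k / 2 * (\<delta>2 k)\<^sup>2"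
      using c[of k] by (auto intro!: mult_right_mono divide_right_mono)
    ultimately show ?thesis unfolding \<gamma>_def by linarith
  qed
  have sq: "0 \<le> c_min / 2 * (\<delta>1 k)\<^sup>2" "0 \<le> c_min / 2 * (\<delta>2 k)\<^sup>2" for k using pos by auto
  have c2: "0 < c_min / 2" using pos by simp
  have dec: "\<gamma> (Suc k) \<le> \<gamma> k - c_min / 2 * (\<delta>1 k)\<^sup>2" "\<gamma> (Suc k) \<le> \<gamma> k - c_min / 2 * (\<delta>2 k)\<^sup>2" for k
    using desc[of k] sq[of k] by linarith+
  note \<delta> = norm_steps_tendsto_0[where \<gamma> = \<gamma> and \<delta> = \<delta>1, OF dec(1) \<gamma> c2]
    norm_steps_tendsto_0[where \<gamma> = \<gamma> and \<delta> = \<delta>2, OF dec(2) \<gamma> c2]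
  have mono: "\<gamma> k \<le> \<gamma> 0" for k
  proof (induction k)
    case (Suc k)
    then show ?case using desc[of k] sq[of k] by linarith
  qed simp

  have limP: "(\<lambda>j. P (r j)) \<longlonglongrightarrow> p_star" and limS: "(\<lambda>j. S (r j)) \<longlonglongrightarrow> s_star"
    using tendsto_Pair[OF tendsto_fst[OF lim] tendsto_fst[OF tendsto_snd[OF lim]]]
      tendsto_snd[OF tendsto_snd[OF lim]] by (auto simp: T_def)
  have "(\<lambda>j. P (Suc (r j)) - P (r j)) \<longlonglongrightarrow> 0" "(\<lambda>j. S (Suc (r j)) - S (r j)) \<longlonglongrightarrow> 0"
    using LIMSEQ_subseq_LIMSEQ[OF \<delta>(1) r] LIMSEQ_subseq_LIMSEQ[OF \<delta>(2) r]
    by (auto simp: o_def \<delta>1_def \<delta>2_def tendsto_norm_zero_iff)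
  from tendsto_add[OF this(1) limP] tendsto_add[OF this(2) limS]
  have limP': "(\<lambda>j. P (Suc (r j))) \<longlonglongrightarrow> p_star" and limS': "(\<lambda>j. S (Suc (r j))) \<longlonglongrightarrow> s_star" by auto

  obtain R' L where R': "0 < R'" and L: "L-lipschitz_on (ball (T p_star s_star) R') g"
    using lipg unfolding locally_lipschitz_def by blast
  \<comment> \<open>The distance of triples is at most the sum of the block distances, so the
    product of two balls of radius \<open>R'/2\<close> fits into the ball of radius
    \<open>R'\<close>.\<close>
  define R where "R = R' / 2"
  have R: "0 < R" using R' by (simp add: R_def)
  have ballT: "T q t \<in> ball (T p_star s_star) R'" if "q \<in> ball p_star R" "t \<in> ball s_star R" for q t
  proof -
    have "dist (T p_star s_star) (T q t) \<le> dist p_star q + dist s_star t"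
      unfolding distT by (rule sqrt_sum_squares_le_sum) auto
    then show ?thesis using that by (simp add: R_def)
  qed
  have L0: "0 \<le> L" by (rule lipschitz_on_nonneg[OF L])
  define B where "B = norm (g (T p_star s_star)) + L * R'"
  have B: "norm (g z) \<le> B" if "z \<in> ball (T p_star s_star) R'" for z
  proof -
    have "norm (g z - g (T p_star s_star)) \<le> L * norm (z - T p_star s_star)"
      using lipschitz_on_normD[OF L that, of "T p_star s_star"] R' by simp
    also have "\<dots> \<le> L * R'"
      using that L0 by (intro mult_left_mono) (auto simp: dist_norm norm_minus_commute)
    finally show ?thesis unfolding B_def using norm_triangle_ineq2[of "g z" "g (T p_star s_star)"] by linarith
  qed
  have norm_parts: "norm (fst z, fst (snd z)) \<le> norm z" "norm (snd (snd z)) \<le> norm z" for z :: "'a \<times> 'b \<times> 'c"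
    by (auto simp: norm_prod_def real_le_rsqrt)
  have g12: "dist (g1 y) (g1 z) \<le> dist (g y) (g z)" "dist (g2 y) (g2 z) \<le> dist (g y) (g z)" for y z
    using norm_parts[of "g y - g z"] by (auto simp: g1_def g2_def dist_norm)
  \<comment> \<open>Slices of \<open>g\<close> inherit its constant \<open>L\<close>, whatever
    nearby value the other block is frozen at.\<close>
  have lip1: "L-lipschitz_on (ball p_star R) (\<lambda>q. g1 (T q t))" if t: "t \<in> ball s_star R" for t
  proof (rule lipschitz_onI[OF _ L0])
    fix q q' assume "q \<in> ball p_star R" "q' \<in> ball p_star R"
    then show "dist (g1 (T q t)) (g1 (T q' t)) \<le> L * dist q q'"
      using order_trans[OF g12(1) lipschitz_onD[OF L ballT[of q t] ballT[of q' t]]] t by (simp add: distT)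
  qed
  have lip2: "L-lipschitz_on (ball s_star R) (\<lambda>t. g2 (T q t))" if q: "q \<in> ball p_star R" for q
  proof (rule lipschitz_onI[OF _ L0])
    fix t t' assume "t \<in> ball s_star R" "t' \<in> ball s_star R"
    then show "dist (g2 (T q t)) (g2 (T q t')) \<le> L * dist t t'"
      using order_trans[OF g12(2) lipschitz_onD[OF L ballT[of q t] ballT[of q t']]] q by (simp add: distT)
  qed
  have grad1: "GDERIV (\<lambda>q. F (T q t)) q :> g1 (T q t)" for q t
  proof -
    have "((\<lambda>q. T q t) has_derivative (\<lambda>h. (fst h, snd h, 0))) (at q)"
      unfolding T_def by (auto intro!: derivative_eq_intros)
    from has_derivative_compose[OF this grad[unfolded gderiv_def]]
    show ?thesis by (simp add: gderiv_def g1_def inner_prod_def)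
  qed
  have grad2: "GDERIV (\<lambda>t. F (T q t)) t :> g2 (T q t)" for q t
  proof -
    have "((\<lambda>t. T q t) has_derivative (\<lambda>h. (0, 0, h))) (at t)"
      unfolding T_def by (auto intro!: derivative_eq_intros)
    from has_derivative_compose[OF this grad[unfolded gderiv_def]]
    show ?thesis by (simp add: gderiv_def g2_def inner_prod_def)
  qed

  have "\<forall>\<^sub>F j in sequentially. P (r j) \<in> ball p_star (R / 2) \<and> S (r j) \<in> ball s_star (R / 2)
      \<and> P (Suc (r j)) \<in> ball p_star (R / 2)"
    using R tendstoD[OF limP, of "R / 2"] tendstoD[OF limS, of "R / 2"] tendstoD[OF limP', of "R / 2"]
    by (simp add: eventually_conj_iff dist_commute)
  then obtain j0 where j0: "\<And>j. j0 \<le> j \<Longrightarrow> P (r j) \<in> ball p_star (R / 2) \<and> S (r j) \<in> ball s_star (R / 2)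
      \<and> P (Suc (r j)) \<in> ball p_star (R / 2)"
    unfolding eventually_sequentially by blast
  \<comment> \<open>The shift makes the localization hold for every index, as
    \<open>prox_step_convergence\<close> demands. The new \<open>P\<close> must be localized too,
    because the second step freezes it.\<close>
  define k where "k j = r (j + j0)" for j
  have near: "P (k j) \<in> ball p_star (R / 2)" "S (k j) \<in> ball s_star (R / 2)"
    "P (Suc (k j)) \<in> ball p_star (R / 2)" for j
    using j0[of "j + j0"] by (auto simp: k_def)
  have "ball p_star (R / 2) \<subseteq> ball p_star R" "ball s_star (R / 2) \<subseteq> ball s_star R" using R by auto
  then have near': "P (k j) \<in> ball p_star R" "S (k j) \<in> ball s_star R" "P (Suc (k j)) \<in> ball p_star R" for j
    using near by blast+
  have lims: "(\<lambda>j. P (k j)) \<longlonglongrightarrow> p_star" "(\<lambda>j. S (k j)) \<longlonglongrightarrow> s_star"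
    "(\<lambda>j. P (Suc (k j))) \<longlonglongrightarrow> p_star" "(\<lambda>j. S (Suc (k j))) \<longlonglongrightarrow> s_star"
    unfolding k_def using limP limS limP' limS' by (auto intro: LIMSEQ_ignore_initial_segment)
  \<comment> \<open>Each nonsmooth value equals \<open>\<gamma>\<close> minus \<open>F\<close> minus
    the other nonsmooth value. Monotonicity of \<open>\<gamma>\<close> and the minorant of the other
    block bound it by a convergent, hence bounded, sequence: \<open>C1\<close> for
    \<open>\<phi>\<close> uses \<open>a2\<close>, \<open>C2\<close> for \<open>\<psi>\<close> uses
    \<open>a1\<close>.\<close>
  have lower: "a1 \<bullet> P i + b1 \<le> p i" "a2 \<bullet> S i + b2 \<le> s i" for i
    using minor1[of "P i"] minor2[of "S i"] by (auto simp: p s)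
  have "(\<lambda>j. \<gamma> 0 - F (T (P (k j)) (S (k j))) - (a2 \<bullet> S (k j) + b2))
      \<longlonglongrightarrow> \<gamma> 0 - F (T p_star s_star) - (a2 \<bullet> s_star + b2)"
    by (intro tendsto_intros contF tendsto_T lims)
  then obtain C1 where C1: "\<And>j. \<gamma> 0 - F (T (P (k j)) (S (k j))) - (a2 \<bullet> S (k j) + b2) \<le> C1"
    by (rule convergent_imp_bounded_above) blast
  have "(\<lambda>j. \<gamma> 0 - F (T (P (k j)) (S (k j))) - (a1 \<bullet> P (k j) + b1))
      \<longlonglongrightarrow> \<gamma> 0 - F (T p_star s_star) - (a1 \<bullet> p_star + b1)"
    by (intro tendsto_intros contF tendsto_T lims)
  then obtain C2 where C2: "\<And>j. \<gamma> 0 - F (T (P (k j)) (S (k j))) - (a1 \<bullet> P (k j) + b1) \<le> C2"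
    by (rule convergent_imp_bounded_above) blast
  have pC: "\<phi> (P (k j)) \<le> ereal C1" and sC: "\<psi> (S (k j)) \<le> ereal C2" for j
    using mono[of "k j"] lower[of "k j"] C1[of j] C2[of j] by (auto simp: p s \<gamma>_def)
  have B1: "norm (g1 (T (P (k j)) (S (k j)))) \<le> B" for j
    using norm_parts(1) B[OF ballT[OF near'(1,2)]] unfolding g1_def by (rule order_trans)
  have B2: "norm (g2 (T (P (Suc (k j))) (S (k j)))) \<le> B" for j
    using norm_parts(2) B[OF ballT[OF near'(3,2)]] unfolding g2_def by (rule order_trans)
  have cm: "c1 i \<le> c_max" "c2 i \<le> c_max" for i using c[of i] by auto
  obtain p' pz e1 K1 where conv1: "\<phi> p_star = ereal pz" "\<And>j. \<phi> (P (Suc (k j))) = ereal (p' j)"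
      "p' \<longlonglongrightarrow> pz" "e1 \<longlonglongrightarrow> 0"
    and sub1: "\<And>j q. ereal (p' j - (g1 (T (P (k j)) (S (k j))) + e1 j) \<bullet> (q - P (Suc (k j)))
        - K1 * (norm (q - P (Suc (k j))))\<^sup>2) \<le> \<phi> q"
    by (rule prox_step_convergence[OF minor1 lsc1 lims(1,3) pC near(1) R grad1 lip1[OF near'(2)] B1 step1
          D(1) cm(1) pos(1-3)]) (assumption, rule that)
  obtain s' sz e2 K2 where conv2: "\<psi> s_star = ereal sz" "\<And>j. \<psi> (S (Suc (k j))) = ereal (s' j)"
      "s' \<longlonglongrightarrow> sz" "e2 \<longlonglongrightarrow> 0"
    and sub2: "\<And>j t. ereal (s' j - (g2 (T (P (Suc (k j))) (S (k j))) + e2 j) \<bullet> (t - S (Suc (k j)))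
        - K2 * (norm (t - S (Suc (k j))))\<^sup>2) \<le> \<psi> t"
    by (rule prox_step_convergence[OF minor2 lsc2 lims(2,4) sC near(2) R grad2 lip2[OF near'(3)] B2 step2
          D(2) cm(2) pos(1-3)]) (assumption, rule that)

  define zs where "zs j = T (P (Suc (k j))) (S (Suc (k j)))" for j
  define d1 d2 where "d1 j = g1 (T (P (k j)) (S (k j))) + e1 j"
    and "d2 j = g2 (T (P (Suc (k j))) (S (k j))) + e2 j" for j
  have zs: "zs \<longlonglongrightarrow> T p_star s_star" unfolding zs_def by (intro tendsto_T lims)
  have Gzs: "(\<lambda>j. G (zs j)) \<longlonglongrightarrow> G (T p_star s_star)"
  proof -
    have "(\<lambda>j. F (zs j) + (p' j + s' j)) \<longlonglongrightarrow> F (T p_star s_star) + (pz + sz)"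
      by (intro tendsto_intros contF zs conv1 conv2)
    then show ?thesis by (simp add: zs_def GT conv1 conv2)
  qed
  \<comment> \<open>\<open>d1\<close> and \<open>d2\<close> use gradients at outdated points: both
    old blocks for \<open>d1\<close>, the new \<open>P\<close> with the old \<open>S\<close> for
    \<open>d2\<close>. These points converge to the same limit as \<open>zs\<close>, so continuity
    of \<open>g\<close> cancels all contributions.\<close>
  have vs: "(\<lambda>j. g (zs j) + T (- d1 j) (- d2 j)) \<longlonglongrightarrow> 0"
  proof -
    have g: "(\<lambda>j. g (T (ps j) (ss j))) \<longlonglongrightarrow> g (T p_star s_star)"
      if "ps \<longlonglongrightarrow> p_star" "ss \<longlonglongrightarrow> s_star" for ps ss
      by (intro locally_lipschitz_tendsto[OF lipg] tendsto_T that)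
    have "d1 \<longlonglongrightarrow> g1 (T p_star s_star) + 0" "d2 \<longlonglongrightarrow> g2 (T p_star s_star) + 0"
      unfolding d1_def g1_def d2_def g2_def by (intro tendsto_intros g lims conv1 conv2)+
    then have "(\<lambda>j. g (zs j) + T (- d1 j) (- d2 j))
        \<longlonglongrightarrow> g (T p_star s_star) + T (- (g1 (T p_star s_star) + 0)) (- (g2 (T p_star s_star) + 0))"
      unfolding zs_def by (intro tendsto_add g tendsto_T tendsto_minus lims)
    then show ?thesis by (simp add: T_def g1_def g2_def prod_eq_iff zero_prod_def plus_prod_def)
  qed
  have "g (zs j) + T (- d1 j) (- d2 j) \<in> regular_subdifferential G (zs j)" for j
  proof -
    define \<Phi> where "\<Phi> = (\<lambda>(x, y, t). \<phi> (x, y) + \<psi> t)"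
    have "g (zs j) + T (- d1 j) (- d2 j) \<in> regular_subdifferential (\<lambda>z. ereal (F z) + \<Phi> z) (zs j)"
    proof (rule regular_subdifferential_smooth_plus_quadratic_minorant[OF grad])
      show "\<Phi> (zs j) = ereal (p' j + s' j)" by (simp add: \<Phi>_def zs_def T_def conv1 conv2)
      fix z
      obtain q t where z: "z = T q t" using that[of "(fst z, fst (snd z))" "snd (snd z)"] by (simp add: T_def)
      define u w where "u = q - P (Suc (k j))" and "w = t - S (Suc (k j))"
      have zz: "z - zs j = T u w" by (simp add: z zs_def T_def u_def w_def)
      have inner: "T (- d1 j) (- d2 j) \<bullet> T u w = - (d1 j \<bullet> u) - d2 j \<bullet> w"
        by (simp add: T_def inner_prod_def)
      have nrm: "(norm (T u w))\<^sup>2 = (norm u)\<^sup>2 + (norm w)\<^sup>2"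
        by (simp add: T_def norm_prod_def)
      have "K1 * (norm u)\<^sup>2 \<le> max K1 K2 * (norm u)\<^sup>2" "K2 * (norm w)\<^sup>2 \<le> max K1 K2 * (norm w)\<^sup>2"
        by (intro mult_right_mono; simp)+
      then have "ereal (p' j + s' j + T (- d1 j) (- d2 j) \<bullet> (z - zs j) - max K1 K2 * (norm (z - zs j))\<^sup>2)
        \<le> ereal (p' j - d1 j \<bullet> u - K1 * (norm u)\<^sup>2) + ereal (s' j - d2 j \<bullet> w - K2 * (norm w)\<^sup>2)"
        unfolding zz inner nrm by (simp add: distrib_left)
      also have "\<dots> \<le> \<phi> q + \<psi> t"
        unfolding u_def w_def d1_def d2_def by (intro add_mono sub1 sub2)
      also have "\<dots> = \<Phi> z" by (simp add: z \<Phi>_def T_def)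
      finally show "ereal (p' j + s' j + T (- d1 j) (- d2 j) \<bullet> (z - zs j) - max K1 K2 * (norm (z - zs j))\<^sup>2)
        \<le> \<Phi> z" .
    qed
    moreover have "(\<lambda>z. ereal (F z) + \<Phi> z) = G" by (auto simp: G_def \<Phi>_def)
    ultimately show ?thesis by simp
  qed
  then show ?thesis unfolding limiting_subdifferential_def
    using zs Gzs vs by (auto simp: GT conv1 conv2)
qed

section \<open>The factorized objective\<close>

lemma bounded_bilinear_matrix_mult:
  "bounded_bilinear (\<lambda>A B. (A::real^'n^'m) ** (B::real^'p^'n))"
  unfolding bilinear_conv_bounded_bilinear[symmetric] bilinear_def
  by (auto intro!: linearI simp: matrix_add_ldistrib matrix_scalar_ac scalar_matrix_assoc)
    (simp add: matrix_matrix_mult_def vec_eq_iff sum.distrib distrib_right)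

lemma bounded_linear_transpose: "bounded_linear (transpose :: real^'n^'m \<Rightarrow> real^'m^'n)"
  unfolding linear_conv_bounded_linear[symmetric]
  by (rule linearI) (auto simp: transpose_def vec_eq_iff)

text \<open>The Frobenius adjoint of right multiplication by \<open>transpose Y\<close> is right
  multiplication by \<open>Y\<close>. It produces the X-component of the gradient; the analogous
  identity in the other factor produces the Y-component.\<close>

lemma inner_matrix_mult_transpose_left:
  fixes A :: "real^'d^'m" and Y :: "real^'d^'n"
  shows "(A ** transpose Y) \<bullet> G = A \<bullet> (G ** Y)"
proof -
  have "(\<Sum>i\<in>UNIV. \<Sum>j\<in>UNIV. \<Sum>l\<in>UNIV. A $ i $ l * Y $ j $ l * G $ i $ j)
      = (\<Sum>i\<in>UNIV. \<Sum>l\<in>UNIV. \<Sum>j\<in>UNIV. A $ i $ l * Y $ j $ l * G $ i $ j)"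
    by (intro sum.cong refl sum.swap)
  then show ?thesis
    by (simp add: inner_vec_def matrix_matrix_mult_def transpose_def sum_distrib_left
        sum_distrib_right mult_ac)
qed

lemma inner_transpose: "transpose A \<bullet> transpose B = A \<bullet> B" for A B :: "real^'n^'m"
  unfolding inner_vec_def transpose_def by simp (rule sum.swap)

lemma inner_matrix_mult_transpose_right:
  fixes X :: "real^'d^'m" and B :: "real^'d^'n"
  shows "(X ** transpose B) \<bullet> G = B \<bullet> (transpose G ** X)"
  by (metis inner_matrix_mult_transpose_left inner_transpose matrix_transpose_mul transpose_transpose)

lemma prox_operator_scaleR_pair:
  assumes "\<iota>1 \<in> {\<iota>_lo..\<iota>_hi}" "\<iota>2 \<in> {\<iota>_lo..\<iota>_hi}" "0 < \<iota>_lo"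
  shows "prox_operator \<iota>_lo \<iota>_hi (\<lambda>d :: 'a::real_inner \<times> 'b::real_inner. (\<iota>1 *\<^sub>R fst d, \<iota>2 *\<^sub>R snd d))"
  unfolding prox_operator_def
proof (intro conjI allI)
  show "linear (\<lambda>d :: 'a \<times> 'b. (\<iota>1 *\<^sub>R fst d, \<iota>2 *\<^sub>R snd d))"
    by (rule linearI) (auto simp: scaleR_add_right)
next
  fix d :: "'a \<times> 'b"
  have "\<iota>_lo * (norm (fst d))\<^sup>2 \<le> \<iota>1 * (norm (fst d))\<^sup>2" "\<iota>_lo * (norm (snd d))\<^sup>2 \<le> \<iota>2 * (norm (snd d))\<^sup>2"
    using assms by (auto intro!: mult_right_mono)
  then show "\<iota>_lo * (norm d)\<^sup>2 \<le> (\<iota>1 *\<^sub>R fst d, \<iota>2 *\<^sub>R snd d) \<bullet> d"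
    by (simp add: norm_prod_def inner_prod_def distrib_left power2_norm_eq_inner)
next
  fix d :: "'a \<times> 'b"
  have "(\<iota>1 * norm (fst d))\<^sup>2 \<le> (\<iota>_hi * norm (fst d))\<^sup>2" "(\<iota>2 * norm (snd d))\<^sup>2 \<le> (\<iota>_hi * norm (snd d))\<^sup>2"
    using assms by (auto intro!: power_mono mult_right_mono)
  then have "(\<iota>1 * norm (fst d))\<^sup>2 + (\<iota>2 * norm (snd d))\<^sup>2 \<le> (\<iota>_hi * norm d)\<^sup>2"
    by (simp add: norm_prod_def power_mult_distrib distrib_left)
  moreover have "0 \<le> \<iota>_hi * norm d" using assms by auto
  ultimately show "norm (\<iota>1 *\<^sub>R fst d, \<iota>2 *\<^sub>R snd d) \<le> \<iota>_hi * norm d"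
    using assms by (simp add: norm_prod_def real_le_lsqrt)
qed (simp add: inner_prod_def)

lemma prox_operator_scaleR_id:
  assumes "\<iota> \<in> {\<iota>_lo..\<iota>_hi}" "0 < \<iota>_lo"
  shows "prox_operator \<iota>_lo \<iota>_hi (\<lambda>d :: 'a::real_inner. \<iota> *\<^sub>R d)"
  unfolding prox_operator_def
  using assms by (auto simp: power2_norm_eq_inner[symmetric] intro!: mult_right_mono linear_scaleR)

text \<open>Local Lipschitz continuity is known for the full gradient, while the models of the
  algorithm use partial gradients; restricting the derivative to a slice identifies them with its
  components.\<close>

lemma gradient_first:
  assumes "GDERIV f (Z, S) :> g"
  shows "gradient_Z f Z S = fst g"
proof (rule gradient_eqI)
  have "((\<lambda>Z'. (Z', S)) has_derivative (\<lambda>h. (h, 0))) (at Z)"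
    by (auto intro!: derivative_eq_intros)
  from has_derivative_compose[OF this assms[unfolded gderiv_def]]
  show "GDERIV (\<lambda>Z'. f (Z', S)) Z :> fst g" by (simp add: gderiv_def inner_prod_def)
qed

lemma gradient_second:
  assumes "GDERIV f (Z, S) :> g"
  shows "gradient_S f Z S = snd g"
proof (rule gradient_eqI)
  have "((\<lambda>S'. (Z, S')) has_derivative (\<lambda>h. (0, h))) (at S)"
    by (auto intro!: derivative_eq_intros)
  from has_derivative_compose[OF this assms[unfolded gderiv_def]]
  show "GDERIV (\<lambda>S'. f (Z, S')) S :> snd g" by (simp add: gderiv_def inner_prod_def)
qed

definition factor_product ::
  "(real^'d^'m) \<times> (real^'d^'n) \<times> (real^'n^'m) \<Rightarrow> (real^'n^'m) \<times> (real^'n^'m)" where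
  "factor_product z = (fst z ** transpose (fst (snd z)), snd (snd z))"

text \<open>The full gradient of \<open>f\<close> pulled back by the adjoint of the derivative of
  \<open>factor_product\<close>; its first two components are the linear coefficients in
  \<open>\<omega>_J\<close>.\<close>

definition factor_gradient ::
  "((real^'n^'m) \<times> (real^'n^'m) \<Rightarrow> real) \<Rightarrow> (real^'d^'m) \<times> (real^'d^'n) \<times> (real^'n^'m)
    \<Rightarrow> (real^'d^'m) \<times> (real^'d^'n) \<times> (real^'n^'m)" where
  "factor_gradient f z = (let G = gradient f (factor_product z) in
     (fst G ** fst (snd z), transpose (fst G) ** fst z, snd G))"

lemma gderiv_factor_gradient:
  assumes "f differentiable (at (factor_product z))"
  shows "GDERIV (\<lambda>z. f (factor_product z)) z :> factor_gradient f z"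
proof -
  let ?G = "gradient f (factor_product z)"
  have T: "((\<lambda>z. transpose (fst (snd z))) has_derivative (\<lambda>h. transpose (fst (snd h)))) (at z)"
    by (intro bounded_linear.has_derivative[OF bounded_linear_transpose] derivative_intros)
  have "(factor_product has_derivative (\<lambda>h. (fst z ** transpose (fst (snd h)) + fst h ** transpose (fst (snd z)),
      snd (snd h)))) (at z)"
    unfolding factor_product_def
    by (intro has_derivative_Pair bounded_bilinear.FDERIV[OF bounded_bilinear_matrix_mult] T derivative_intros)
  from has_derivative_compose[OF this gderiv_gradient[OF assms, unfolded gderiv_def]]
  have "((\<lambda>z. f (factor_product z)) has_derivative
      (\<lambda>h. (fst z ** transpose (fst (snd h)) + fst h ** transpose (fst (snd z)), snd (snd h)) \<bullet> ?G)) (at z)" .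
  moreover have "(fst z ** transpose (fst (snd h)) + fst h ** transpose (fst (snd z)), snd (snd h)) \<bullet> ?G
      = h \<bullet> factor_gradient f z" for h
    using inner_matrix_mult_transpose_left[of "fst h" "fst (snd z)" "fst ?G"]
      inner_matrix_mult_transpose_right[of "fst z" "fst (snd h)" "fst ?G"]
    by (simp add: factor_gradient_def Let_def inner_prod_def inner_add_left)
  ultimately show ?thesis by (simp add: gderiv_def)
qed

text \<open>Every component is built from projections, transposition, matrix products and
  \<open>gradient f\<close>, and the preceding calculus is closed under these operations.\<close>

lemma locally_lipschitz_factor_gradient:
  fixes f :: "(real^'n^'m) \<times> (real^'n^'m) \<Rightarrow> real"
  assumes "locally_lipschitz (gradient f)"
  shows "locally_lipschitz (factor_gradient f :: (real^'d^'m) \<times> (real^'d^'n) \<times> (real^'n^'m) \<Rightarrow> _)"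
proof -
  note mult = locally_lipschitz_compose[OF bounded_bilinear.locally_lipschitz[OF bounded_bilinear_matrix_mult]
      locally_lipschitz_Pair, simplified]
  note lin = locally_lipschitz_bounded_linear
  note transp = locally_lipschitz_compose[OF lin[OF bounded_linear_transpose]]
  have proj: "locally_lipschitz (\<lambda>z :: (real^'d^'m) \<times> (real^'d^'n) \<times> (real^'n^'m). fst z)"
    "locally_lipschitz (\<lambda>z :: (real^'d^'m) \<times> (real^'d^'n) \<times> (real^'n^'m). fst (snd z))"
    "locally_lipschitz (\<lambda>z :: (real^'d^'m) \<times> (real^'d^'n) \<times> (real^'n^'m). snd (snd z))"
    by (intro lin bounded_linear_fst bounded_linear_compose[OF bounded_linear_fst bounded_linear_snd]
        bounded_linear_compose[OF bounded_linear_snd bounded_linear_snd])+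
  have "locally_lipschitz (factor_product :: (real^'d^'m) \<times> (real^'d^'n) \<times> (real^'n^'m) \<Rightarrow> _)"
    unfolding factor_product_def by (intro locally_lipschitz_Pair mult transp proj)
  from locally_lipschitz_compose[OF assms this]
  have G: "locally_lipschitz (\<lambda>z :: (real^'d^'m) \<times> (real^'d^'n) \<times> (real^'n^'m). gradient f (factor_product z))" .
  note G1 = locally_lipschitz_compose[OF lin[OF bounded_linear_fst] G]
  note G2 = locally_lipschitz_compose[OF lin[OF bounded_linear_snd] G]
  show ?thesis
    unfolding factor_gradient_def Let_def
    by (intro locally_lipschitz_Pair mult transp proj G1 G2)
qed

section \<open>The steps of the algorithm as abstract proximal steps\<close>

lemma JA_PG_step1_imp_prox_step:
  assumes "\<forall>p. f differentiable (at p)"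
    and "JA_PG_step1 f u v lam \<rho> \<iota>1 \<iota>2 c X Y S X' Y'"
  shows "prox_step (\<lambda>(X, Y). ereal lam * (u X + v Y)) (\<lambda>p. f (factor_product (fst p, snd p, S))) \<rho>
     (\<lambda>d. (\<iota>1 *\<^sub>R fst d, \<iota>2 *\<^sub>R snd d))
     (fst (factor_gradient f (X, Y, S)), fst (snd (factor_gradient f (X, Y, S)))) c (X, Y) (X', Y')"
proof -
  \<comment> \<open>Here \<open>r\<close> stands for the backtracking factor. Both step parameters
    are multiplied by the same factor, so one block-diagonal operator, scaled by \<open>r\<close>,
    describes all trials.\<close>
  have "\<omega>_J f u v lam X Y S (\<iota>1 * r) (\<iota>2 * r) = prox_model (\<lambda>(X, Y). ereal lam * (u X + v Y))
     (\<lambda>d. r *\<^sub>R (\<iota>1 *\<^sub>R fst d, \<iota>2 *\<^sub>R snd d))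
     (fst (factor_gradient f (X, Y, S)), fst (snd (factor_gradient f (X, Y, S)))) (X, Y)" for r
    using gradient_first[OF gderiv_gradient[OF assms(1)[rule_format]]]
    by (auto simp: \<omega>_J_def prox_model_def fun_eq_iff factor_gradient_def factor_product_def Let_def
        inner_prod_def power2_norm_eq_inner add_divide_distrib mult_ac add_ac distrib_left)
  moreover have "f_J f u v lam S
      = (\<lambda>p. ereal (f (factor_product (fst p, snd p, S))) + (case p of (X, Y) \<Rightarrow> ereal lam * (u X + v Y)))"
    by (auto simp: f_J_def factor_product_def)
  ultimately show ?thesis using assms(2) unfolding JA_PG_step1_def prox_step_def by simp
qed

lemma JA_PG_step2_imp_prox_step:
  assumes "\<forall>p. f differentiable (at p)"
    and "JA_PG_step2 f w \<beta> \<rho> \<iota> c X Y S S'"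
  shows "prox_step (\<lambda>S. ereal \<beta> * w S) (\<lambda>S. f (factor_product (X, Y, S))) \<rho>
     (\<lambda>d. \<iota> *\<^sub>R d) (snd (snd (factor_gradient f (X, Y, S)))) c S S'"
proof -
  have "\<omega>_A f w \<beta> X Y S (\<iota> * r) = prox_model (\<lambda>S. ereal \<beta> * w S)
     (\<lambda>d. r *\<^sub>R (\<iota> *\<^sub>R d)) (snd (snd (factor_gradient f (X, Y, S)))) S" for r
    using gradient_second[OF gderiv_gradient[OF assms(1)[rule_format]]]
    by (auto simp: \<omega>_A_def prox_model_def fun_eq_iff factor_gradient_def factor_product_def Let_def
        power2_norm_eq_inner mult_ac add_ac distrib_left)
  moreover have "f_A f w \<beta> X Y = (\<lambda>S. ereal (f (factor_product (X, Y, S))) + ereal \<beta> * w S)"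
    by (auto simp: f_A_def factor_product_def)
  ultimately show ?thesis using assms(2) unfolding JA_PG_step2_def prox_step_def by simp
qed

lemma scaled_liminf:
  assumes "0 \<le> lam" "l \<le> liminf h"
  shows "ereal lam * l \<le> liminf (\<lambda>j. ereal lam * h j)"
  using assms by (simp add: Liminf_ereal_mult_left ereal_mult_left_mono)

theorem theorem4:
  fixes f :: "(real^'n^'m) \<times> (real^'n^'m) \<Rightarrow> real"
    and u :: "real^'d^'m \<Rightarrow> ereal" and v :: "real^'d^'n \<Rightarrow> ereal" and w :: "real^'n^'m \<Rightarrow> ereal"
    and lam \<beta> \<iota>_lo \<iota>_hi c_min c_max \<rho> :: real
    and \<iota>B1 \<iota>B2 \<iota>B c1 c2 :: "nat \<Rightarrow> real"
    and X :: "nat \<Rightarrow> real^'d^'m" and Y :: "nat \<Rightarrow> real^'d^'n" and S :: "nat \<Rightarrow> real^'n^'m"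
    and X_star :: "real^'d^'m" and Y_star :: "real^'d^'n" and S_star :: "real^'n^'m"
  assumes "\<forall>p. f differentiable (at p)" and "locally_lipschitz (gradient f)"
    and "0 \<le> lam" and "0 \<le> \<beta>"
    and "proper_fun u" and "lsc_fun u" and "affinely_minorized u"
    and "proper_fun v" and "lsc_fun v" and "affinely_minorized v"
    and "proper_fun w" and "lsc_fun w" and "affinely_minorized w"
    and "(INF p. GF_objective f u v w lam \<beta> p) > -\<infinity>"
    and "0 < \<iota>_lo" and "\<iota>_lo \<le> \<iota>_hi" and "0 < c_min" and "c_min \<le> c_max" and "1 < \<rho>"
    and "\<forall>k. \<iota>B1 k \<in> {\<iota>_lo..\<iota>_hi}" and "\<forall>k. \<iota>B2 k \<in> {\<iota>_lo..\<iota>_hi}"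
    and "\<forall>k. \<iota>B k \<in> {\<iota>_lo..\<iota>_hi}"
    and "\<forall>k. c1 k \<in> {c_min..c_max}" and "\<forall>k. c2 k \<in> {c_min..c_max}"
    and "JA_PG_sequence f u v w lam \<beta> \<rho> \<iota>B1 \<iota>B2 \<iota>B c1 c2 X Y S"
    and "accumulation_point (\<lambda>k. (X k, Y k, S k)) (X_star, Y_star, S_star)"
  shows "0 \<in> limiting_subdifferential (GF_objective f u v w lam \<beta>) (X_star, Y_star, S_star)"
proof -
  \<comment> \<open>A zero weight gives the zero function even at infinite values. Minorants and
    lower semicontinuity survive multiplication by any nonnegative weight, so no case distinction on
    \<open>lam\<close> or \<open>\<beta>\<close> occurs.\<close>
  define \<phi> where "\<phi> = (\<lambda>(X, Y). ereal lam * (u X + v Y))"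
  define \<psi> where "\<psi> = (\<lambda>S. ereal \<beta> * w S)"
  have G: "GF_objective f u v w lam \<beta>
      = (\<lambda>(X, Y, S). ereal (f (factor_product (X, Y, S))) + (\<phi> (X, Y) + \<psi> S))"
    by (auto simp: GF_objective_def factor_product_def \<phi>_def \<psi>_def add.assoc)
  obtain au bu av bv aw bw where au: "\<And>X. ereal (au \<bullet> X + bu) \<le> u X"
    and av: "\<And>Y. ereal (av \<bullet> Y + bv) \<le> v Y" and aw: "\<And>S. ereal (aw \<bullet> S + bw) \<le> w S"
    using assms(7,10,13) unfolding affinely_minorized_def by metis
  have minor1: "ereal ((lam *\<^sub>R au, lam *\<^sub>R av) \<bullet> p + lam * (bu + bv)) \<le> \<phi> p" for p
  proof -
    have "ereal lam * (ereal (au \<bullet> fst p + bu) + ereal (av \<bullet> snd p + bv)) \<le> ereal lam * (u (fst p) + v (snd p))"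
      using assms(3) au av by (intro ereal_mult_left_mono add_mono) auto
    then show ?thesis by (simp add: \<phi>_def inner_prod_def split_beta algebra_simps)
  qed
  have minor2: "ereal ((\<beta> *\<^sub>R aw) \<bullet> s + \<beta> * bw) \<le> \<psi> s" for s
    using ereal_mult_left_mono[OF aw[of s], of "ereal \<beta>"] assms(4)
    by (simp add: \<psi>_def algebra_simps)
  have lsc1: "\<phi> p \<le> liminf (\<lambda>j. \<phi> (ps j))" if ps: "ps \<longlonglongrightarrow> p" for ps p
  proof -
    have u: "u (fst p) \<le> liminf (\<lambda>j. u (fst (ps j)))" and v: "v (snd p) \<le> liminf (\<lambda>j. v (snd (ps j)))"
      using lsc_fun_liminf[OF assms(6) tendsto_fst[OF ps]] lsc_fun_liminf[OF assms(9) tendsto_snd[OF ps]] by auto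
    \<comment> \<open>With lower semicontinuity this keeps both lower limits away from
      \<open>-\<infinity>\<close>, so the sum of the lower limits is not of the form
      \<open>\<infinity> + -\<infinity>\<close>.\<close>
    moreover have "u (fst p) \<noteq> -\<infinity>" "v (snd p) \<noteq> -\<infinity>"
      using assms(5,8) by (auto simp: proper_fun_def)
    ultimately have "liminf (\<lambda>j. u (fst (ps j))) + liminf (\<lambda>j. v (snd (ps j)))
        \<le> liminf (\<lambda>j. u (fst (ps j)) + v (snd (ps j)))"
      by (intro ereal_liminf_add_mono) auto
    with u v have "u (fst p) + v (snd p) \<le> liminf (\<lambda>j. u (fst (ps j)) + v (snd (ps j)))"
      by (meson add_mono order_trans)
    from scaled_liminf[OF assms(3) this] show ?thesis by (simp add: \<phi>_def split_beta)
  qed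
  have lsc2: "\<psi> s \<le> liminf (\<lambda>j. \<psi> (ss j))" if "ss \<longlonglongrightarrow> s" for ss s
    unfolding \<psi>_def by (intro scaled_liminf assms lsc_fun_liminf that)
  obtain lb where lb: "\<And>z. ereal lb \<le> GF_objective f u v w lam \<beta> z"
  proof -
    obtain lb where "ereal lb \<le> (INF p. GF_objective f u v w lam \<beta> p)"
      using assms(14) by (metis ereal_dense2 less_imp_le)
    then show thesis using that by (meson INF_lower UNIV_I order_trans)
  qed
  obtain r where r: "strict_mono r" "(\<lambda>j. (X (r j), Y (r j), S (r j))) \<longlonglongrightarrow> (X_star, Y_star, S_star)"
    using assms(26) by (auto simp: accumulation_point_def o_def)
  have init: "GF_objective f u v w lam \<beta> (X 0, Y 0, S 0) < \<infinity>"
    and steps: "\<And>k. JA_PG_step1 f u v lam \<rho> (\<iota>B1 k) (\<iota>B2 k) (c1 k)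
            (X k) (Y k) (S k) (X (Suc k)) (Y (Suc k))"
    "\<And>k. JA_PG_step2 f w \<beta> \<rho> (\<iota>B k) (c2 k) (X (Suc k)) (Y (Suc k)) (S k) (S (Suc k))"
    using assms(25) by (auto simp: JA_PG_sequence_def effective_domain_def)
  \<comment> \<open>The limit is spelled with \<open>fst\<close> and \<open>snd\<close> to match the
    unfolded map \<open>T\<close> of the abstract result.\<close>
  have "0 \<in> limiting_subdifferential
      (\<lambda>(X, Y, S). ereal (f (factor_product (X, Y, S))) + (\<phi> (X, Y) + \<psi> S))
      (fst (X_star, Y_star), snd (X_star, Y_star), S_star)"
  proof (rule alternating_prox_gradient_critical[where P = "\<lambda>k. (X k, Y k)" and S = S
        and g = "factor_gradient f" and r = r and ?a1.0 = "(lam *\<^sub>R au, lam *\<^sub>R av)"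
        and ?b1.0 = "lam * (bu + bv)" and ?a2.0 = "\<beta> *\<^sub>R aw" and ?b2.0 = "\<beta> * bw"
        and c_min = c_min and c_max = c_max])
    show "\<And>z. GDERIV (\<lambda>z. f (factor_product z)) z :> factor_gradient f z"
      by (rule gderiv_factor_gradient[OF assms(1)[rule_format]])
    show "locally_lipschitz (factor_gradient f)"
      by (rule locally_lipschitz_factor_gradient[OF assms(2)])
    show "prox_step \<phi> (\<lambda>p. f (factor_product (fst p, snd p, S k))) \<rho>
        (\<lambda>d. (\<iota>B1 k *\<^sub>R fst d, \<iota>B2 k *\<^sub>R snd d))
        (fst (factor_gradient f (fst (X k, Y k), snd (X k, Y k), S k)),
         fst (snd (factor_gradient f (fst (X k, Y k), snd (X k, Y k), S k))))
        (c1 k) (X k, Y k) (X (Suc k), Y (Suc k))" for k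
      using JA_PG_step1_imp_prox_step[OF assms(1) steps(1)] by (simp add: \<phi>_def)
    show "prox_step \<psi> (\<lambda>s. f (factor_product (fst (X (Suc k), Y (Suc k)), snd (X (Suc k), Y (Suc k)), s))) \<rho>
        (\<lambda>d. \<iota>B k *\<^sub>R d)
        (snd (snd (factor_gradient f (fst (X (Suc k), Y (Suc k)), snd (X (Suc k), Y (Suc k)), S k))))
        (c2 k) (S k) (S (Suc k))" for k
      using JA_PG_step2_imp_prox_step[OF assms(1) steps(2)] by (simp add: \<psi>_def)
    show "prox_operator \<iota>_lo \<iota>_hi (\<lambda>d. (\<iota>B1 k *\<^sub>R fst d, \<iota>B2 k *\<^sub>R snd d))"
      "prox_operator \<iota>_lo \<iota>_hi (\<lambda>d. \<iota>B k *\<^sub>R d)" for k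
      using assms by (auto intro!: prox_operator_scaleR_pair prox_operator_scaleR_id)
  qed (use minor1 minor2 lsc1 lsc2 lb init assms(15-19,23,24) r in \<open>simp_all add: G\<close>)
  then show ?thesis by (simp add: G)
qed

end
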